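(* Let $K$ be an algebraically closed field, $G$ a finite group, $D=D(G)$ its Drinfel'd double and $g\ge 0$. Let $M^g=K[\Omega^g]$, $\Omega^g=\mathrm{Hom}(\pi_1(\Sigma_g,x),G)$, be the linearized representation variety, and let $W=L^{\otimes g}$ with $L=D^*$, with subspace $W_e=(L^{\otimes g})_e$, both equipped with the actions of the mapping class group $\Gamma_g(x)$ described in the context. Then the $K$-linear map $$\tilde\Theta\colon M^g\to W_e=(L^{\otimes g})_e$$ that maps a basis element $f\in\mathrm{Hom}(\pi_1(\Sigma_g,x),G)$ to $$\tilde\Theta(f)=u(a_1,b_1^{-1})\otimes\cdots\otimes u(a_g,b_g^{-1}),$$ where $a_i=f([\alpha_i])$ and $b_i=f([\beta_i])$ for $i=1,\dots,g$, is (well defined and) an isomorphism of the $\Gamma_g(x)$-modules $M^g$ and $W_e$.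
   Context: Let $e$ be the unit of $G$, $[a,b]=aba^{-1}b^{-1}$, and let $\delta_{a,b}$ be the Kronecker symbol. $D=D(G)$ has basis $\delta_a\otimes b$ ($a,b\in G$), product $(\delta_a\otimes b)(\delta_c\otimes d)=\delta_{a,bcb^{-1}}\,\delta_a\otimes bd$, unit $\varepsilon\otimes e$ with $\varepsilon=\sum_a\delta_a$, coproduct $\Delta(\delta_a\otimes b)=\sum_{c\in G}(\delta_c\otimes b)\otimes(\delta_{ac^{-1}}\otimes b)$ and counit $\delta_a\otimes b\mapsto\delta_{a,e}$. $L=D^*$ has the basis $u(a,b)$ ($a,b\in G$) dual to the basis $\delta_a\otimes b$; it is a $D$-module by the left coadjoint action, i.e. $(\varepsilon\otimes h).u(a,b)=u(hah^{-1},hbh^{-1})$ and $(\delta_h\otimes e).u(a,b)=\delta_{h,[b^{-1},a]}\,u(a,b)$. $L^{\otimes g}$ is a $D$-module via the coproduct ($L^{\otimes 0}=K$). For a $D$-module $W$, $W_e=\{w\in W\mid(\delta_e\otimes e).w=w\}$. $\Sigma_g$ is the closed oriented surface of genus $g$ with base point $x$; $\pi_1(\Sigma_g,x)$ is generated by $[\alpha_1],[\beta_1],\dots,[\alpha_g],[\beta_g]$ with the single defining relation $[[\alpha_1],[\beta_1]]\cdots[[\alpha_g],[\beta_g]]=1$. $\Gamma_g(x)$ is the group of isotopy classes of orientation-preserving diffeomorphisms of $\Sigma_g$ fixing $x$ (isotopies fixing $x$). It acts on $\pi_1(\Sigma_g,x)$ (for $g\ge1$ faithfully); for $g=0$ it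 is trivial. For $g\ge 1$ it is generated by classes $\mathfrak t_i,\mathfrak s_i$ ($1\le i\le g$) and $\mathfrak n_l$ ($1\le l\le g-1$) that act on $\pi_1(\Sigma_g,x)$ as follows (generators not mentioned are fixed): $\mathfrak t_i\colon\beta_i\mapsto\beta_i\alpha_i$; $\mathfrak s_i\colon\alpha_i\mapsto\alpha_i\beta_i\alpha_i^{-1},\ \beta_i\mapsto\alpha_i^{-1}$; $\mathfrak n_l\colon\beta_l\mapsto\mu_l\beta_l,\ \alpha_{l+1}\mapsto\mu_l\alpha_{l+1}\mu_l^{-1},\ \beta_{l+1}\mapsto\beta_{l+1}\mu_l^{-1}$, where $\mu_l=\alpha_{l+1}^{-1}\beta_l\alpha_l\beta_l^{-1}$. Action on $M^g$: $M^g$ is the vector space with basis $\Omega^g$, and $[\psi]\in\Gamma_g(x)$ acts by linear extension of $([\psi].f)([\gamma])=f([\psi^{-1}\circ\gamma])$. Action on $W_e$: this is the action of Lyubashenko coming from the R-matrix $\tilde R=\sum_{a,b}(\delta_a\otimes e)\otimes(\delta_b\otimes a^{-1})$ of $D$. It is the (well-defined) action in which $\mathfrak t_i$ and $\mathfrak s_i$ act by the restrictions to $W_e$ of $\mathrm{id}_{L^{\otimes(i-1)}}\otimes\tilde{\mathfrak T}\otimes\mathrm{id}_{L^{\otimes(g-i)}}$ and $\mathrm{id}_{L^{\otimes(i-1)}}\otimes\tilde{\mathfrak S}\otimes\mathrm{id}_{L^{\otimes(g-i)}}$, and $\mathfrak n_l$ acts by the restriction of $\mathrm{id}_{L^{\otimes(l-1)}}\otimes\tilde{\mathfrak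 N}\otimes\mathrm{id}_{L^{\otimes(g-l-1)}}$, where $\tilde{\mathfrak T}(u(c,d))=u(c,cd)$, $\tilde{\mathfrak S}(u(c,d))=u(d,d^{-1}c^{-1}d)$, and $\tilde{\mathfrak N}(u(c,d)\otimes u(c',d'))=u(c,dn)\otimes u(n^{-1}c'n,n^{-1}d')$ with $n=c'^{-1}d^{-1}cd$. *)

theory Defs
  imports "HOL-Homology.Homology" "HOL-Analysis.Cross3" "HOL-Computational_Algebra.Computational_Algebra"
begin

section \<open>Free vector spaces\<close>

text \<open>
  The vector space with basis \<open>B\<close> is the set of finitely supported functions with support in
  \<open>B\<close>. Tensor products of such spaces are free on the product (or, below, the concatenation) of
  the bases.
\<close>

definition fscale :: "'k::field \<Rightarrow> ('b \<Rightarrow>\<^sub>0 'k) \<Rightarrow> ('b \<Rightarrow>\<^sub>0 'k)"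
  where "fscale c v = Poly_Mapping.map (\<lambda>z. c * z) v"

definition bas :: "'b \<Rightarrow> ('b \<Rightarrow>\<^sub>0 'k::field)"
  where "bas b = Poly_Mapping.single b 1"

definition free_space :: "'b set \<Rightarrow> ('b \<Rightarrow>\<^sub>0 'k::field) set"
  where "free_space B = {v. Poly_Mapping.keys v \<subseteq> B}"

definition lin_ext :: "('b \<Rightarrow> ('c \<Rightarrow>\<^sub>0 'k)) \<Rightarrow> ('b \<Rightarrow>\<^sub>0 'k::field) \<Rightarrow> ('c \<Rightarrow>\<^sub>0 'k)"
  where "lin_ext \<phi> v = (\<Sum>b\<in>Poly_Mapping.keys v. fscale (Poly_Mapping.lookup v b) (\<phi> b))"

lemma lookup_fscale [simp]: "Poly_Mapping.lookup (fscale c v) b = c * Poly_Mapping.lookup v b"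
  by (simp add: fscale_def Poly_Mapping.map.rep_eq when_def)

lemma vector_space_fscale: "vector_space (fscale :: 'k::field \<Rightarrow> ('b \<Rightarrow>\<^sub>0 'k) \<Rightarrow> _)"
  by unfold_locales (auto intro!: poly_mapping_eqI simp: lookup_add algebra_simps)

lemma fscale_one [simp]: "fscale 1 v = v"
  by (auto intro!: poly_mapping_eqI)

lemma lin_ext_bas [simp]: "lin_ext \<phi> (bas b) = \<phi> b"
  by (simp add: lin_ext_def bas_def)

lemma lin_ext_eq_sum:
  assumes "finite A" "Poly_Mapping.keys v \<subseteq> A"
  shows "lin_ext \<phi> v = (\<Sum>b\<in>A. fscale (Poly_Mapping.lookup v b) (\<phi> b))"
  unfolding lin_ext_def
  by (rule sum.mono_neutral_left)
     (use assms in \<open>auto intro!: poly_mapping_eqI simp: in_keys_iff\<close>)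

lemma lin_ext_add:
  fixes v w :: "'a \<Rightarrow>\<^sub>0 'b::field" and \<phi> :: "'a \<Rightarrow> 'c \<Rightarrow>\<^sub>0 'b"
  shows "lin_ext \<phi> (v + w) = lin_ext \<phi> v + lin_ext \<phi> w"
proof -
  let ?A = "Poly_Mapping.keys v \<union> Poly_Mapping.keys w"
  have *: "fscale (a + b) z = fscale a z + fscale b z" for a b and z :: "'c \<Rightarrow>\<^sub>0 'b"
    by (auto intro!: poly_mapping_eqI simp: lookup_add algebra_simps)
  show ?thesis
    using keys_add[of v w]
    by (subst (1 2 3) lin_ext_eq_sum[where A = ?A])
       (auto simp: lookup_add * sum.distrib)
qed

lemma lin_ext_zero [simp]: "lin_ext \<phi> 0 = 0"
  by (simp add: lin_ext_def)

lemma lin_ext_sum: "lin_ext \<phi> (\<Sum>i\<in>I. v i) = (\<Sum>i\<in>I. lin_ext \<phi> (v i))"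
  by (induction I rule: infinite_finite_induct) (auto simp: lin_ext_add)

definition linear_betw ::
    "('b \<Rightarrow>\<^sub>0 'k::field) set \<Rightarrow> ('c \<Rightarrow>\<^sub>0 'k) set \<Rightarrow> (('b \<Rightarrow>\<^sub>0 'k) \<Rightarrow> ('c \<Rightarrow>\<^sub>0 'k)) \<Rightarrow> bool"
  where "linear_betw V W f \<longleftrightarrow>
    f ` V \<subseteq> W \<and>
    (\<forall>v\<in>V. \<forall>w\<in>V. f (v + w) = f v + f w) \<and>
    (\<forall>c. \<forall>v\<in>V. f (fscale c v) = fscale c (f v))"


section \<open>Modules over a group\<close>

definition group_module ::
    "('h, 'n) monoid_scheme \<Rightarrow> ('b \<Rightarrow>\<^sub>0 'k::field) set \<Rightarrow> ('h \<Rightarrow> ('b \<Rightarrow>\<^sub>0 'k) \<Rightarrow> ('b \<Rightarrow>\<^sub>0 'k)) \<Rightarrow> bool"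
  where "group_module H V \<rho> \<longleftrightarrow>
    group H \<and> Modules.module.subspace fscale V \<and>
    (\<forall>h\<in>carrier H. linear_betw V V (\<rho> h)) \<and>
    (\<forall>v\<in>V. \<rho> \<one>\<^bsub>H\<^esub> v = v) \<and>
    (\<forall>h\<in>carrier H. \<forall>k\<in>carrier H. \<forall>v\<in>V. \<rho> (h \<otimes>\<^bsub>H\<^esub> k) v = \<rho> h (\<rho> k v))"

definition group_module_iso ::
    "('h, 'n) monoid_scheme \<Rightarrow> ('b \<Rightarrow>\<^sub>0 'k::field) set \<Rightarrow> ('h \<Rightarrow> ('b \<Rightarrow>\<^sub>0 'k) \<Rightarrow> ('b \<Rightarrow>\<^sub>0 'k)) \<Rightarrow>
      ('c \<Rightarrow>\<^sub>0 'k) set \<Rightarrow> ('h \<Rightarrow> ('c \<Rightarrow>\<^sub>0 'k) \<Rightarrow> ('c \<Rightarrow>\<^sub>0 'k)) \<Rightarrow> (('b \<Rightarrow>\<^sub>0 'k) \<Rightarrow> ('c \<Rightarrow>\<^sub>0 'k)) \<Rightarrow> bool"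
  where "group_module_iso H V \<rho> W \<sigma> f \<longleftrightarrow>
    group_module H V \<rho> \<and> group_module H W \<sigma> \<and>
    linear_betw V W f \<and> bij_betw f V W \<and>
    (\<forall>h\<in>carrier H. \<forall>v\<in>V. f (\<rho> h v) = \<sigma> h (f v))"


section \<open>The Drinfel'd double of a finite group\<close>

text \<open>
  The basis element \<open>\<delta>_a \<otimes> b\<close> of \<open>D = D(G)\<close> is \<open>bas (a, b)\<close>; the basis of \<open>D \<otimes> D\<close> is indexed by
  pairs of such pairs.
\<close>

definition dbl :: "('g, 'm) monoid_scheme \<Rightarrow> ('g \<times> 'g \<Rightarrow>\<^sub>0 'k::field) set"
  where "dbl G = free_space (carrier G \<times> carrier G)"

definition dbl_mult ::
    "('g, 'm) monoid_scheme \<Rightarrow> ('g \<times> 'g \<Rightarrow>\<^sub>0 'k::field) \<Rightarrow> ('g \<times> 'g \<Rightarrow>\<^sub>0 'k) \<Rightarrow> ('g \<times> 'g \<Rightarrow>\<^sub>0 'k)"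
  where "dbl_mult G x y =
    lin_ext (\<lambda>(a, b). lin_ext (\<lambda>(c, d).
      if a = b \<otimes>\<^bsub>G\<^esub> c \<otimes>\<^bsub>G\<^esub> inv\<^bsub>G\<^esub> b then bas (a, b \<otimes>\<^bsub>G\<^esub> d) else 0) y) x"

definition dbl_eps :: "('g, 'm) monoid_scheme \<Rightarrow> 'g \<Rightarrow> ('g \<times> 'g \<Rightarrow>\<^sub>0 'k::field)"
  \<comment> \<open>\<open>\<epsilon> \<otimes> h\<close>\<close>
  where "dbl_eps G h = (\<Sum>a\<in>carrier G. bas (a, h))"

definition dbl_comult ::
    "('g, 'm) monoid_scheme \<Rightarrow> ('g \<times> 'g \<Rightarrow>\<^sub>0 'k::field) \<Rightarrow> (('g \<times> 'g) \<times> ('g \<times> 'g) \<Rightarrow>\<^sub>0 'k)"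
  where "dbl_comult G =
    lin_ext (\<lambda>(a, b). \<Sum>c\<in>carrier G. bas ((c, b), (a \<otimes>\<^bsub>G\<^esub> inv\<^bsub>G\<^esub> c, b)))"

definition dbl_counit :: "('g, 'm) monoid_scheme \<Rightarrow> ('g \<times> 'g \<Rightarrow>\<^sub>0 'k::field) \<Rightarrow> 'k"
  where "dbl_counit G x =
    (\<Sum>(a, b)\<in>Poly_Mapping.keys x. Poly_Mapping.lookup x (a, b) * (if a = \<one>\<^bsub>G\<^esub> then 1 else 0))"


section \<open>The module \<open>L = D\<^sup>*\<close> and its tensor powers\<close>

text \<open>
  A functional on \<open>D\<close> is given by its values on the basis of \<open>D\<close>, so \<open>L\<close> is free on the dual basis
  \<open>u(a,b)\<close>. Elements of \<open>L\<^sup>\<otimes>\<^sup>n\<close> are combinations of words of length \<open>n\<close> over \<open>G \<times> G\<close>, the word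
  \<open>[(a\<^sub>1,b\<^sub>1),\<dots>,(a\<^sub>n,b\<^sub>n)]\<close> standing for \<open>u(a\<^sub>1,b\<^sub>1) \<otimes> \<dots> \<otimes> u(a\<^sub>n,b\<^sub>n)\<close>; in particular
  \<open>L\<^sup>\<otimes>\<^sup>0 = K\<close> has the empty word as its basis, and the tensor product
  \<open>L\<^sup>\<otimes>\<^sup>p \<times> L\<^sup>\<otimes>\<^sup>q \<rightarrow> L\<^sup>\<otimes>\<^sup>p\<^sup>+\<^sup>q\<close> is induced by concatenation.
\<close>

type_synonym ('g, 'k) tensors = "('g \<times> 'g) list \<Rightarrow>\<^sub>0 'k"

definition Ltens :: "('g, 'm) monoid_scheme \<Rightarrow> nat \<Rightarrow> ('g, 'k::field) tensors set"
  where "Ltens G n = free_space {w. length w = n \<and> set w \<subseteq> carrier G \<times> carrier G}"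

definition u :: "'g \<Rightarrow> 'g \<Rightarrow> ('g, 'k::field) tensors"
  where "u a b = bas [(a, b)]"

definition tens :: "('g, 'k::field) tensors \<Rightarrow> ('g, 'k) tensors \<Rightarrow> ('g, 'k) tensors"
  where "tens v w = lin_ext (\<lambda>xs. lin_ext (\<lambda>ys. bas (xs @ ys)) w) v"

definition tens_list :: "('g, 'k::field) tensors list \<Rightarrow> ('g, 'k) tensors"
  where "tens_list vs = foldr tens vs (bas [])"

text \<open>\<open>id \<otimes> F \<otimes> id\<close> with \<open>F\<close> acting on the tensor factors \<open>p + 1, \<dots>, p + k\<close>\<close>

definition tens_op ::
    "nat \<Rightarrow> nat \<Rightarrow> (('g, 'k::field) tensors \<Rightarrow> ('g, 'k) tensors) \<Rightarrow> ('g, 'k) tensors \<Rightarrow> ('g, 'k) tensors"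
  where "tens_op p k F =
    lin_ext (\<lambda>w. tens (bas (take p w)) (tens (F (bas (take k (drop p w)))) (bas (drop (p + k) w))))"

definition conj_by :: "('g, 'm) monoid_scheme \<Rightarrow> 'g \<Rightarrow> 'g \<Rightarrow> 'g"
  where "conj_by G h a = h \<otimes>\<^bsub>G\<^esub> a \<otimes>\<^bsub>G\<^esub> inv\<^bsub>G\<^esub> h"

definition commutator :: "('g, 'm) monoid_scheme \<Rightarrow> 'g \<Rightarrow> 'g \<Rightarrow> 'g"
  where "commutator G a b = a \<otimes>\<^bsub>G\<^esub> b \<otimes>\<^bsub>G\<^esub> inv\<^bsub>G\<^esub> a \<otimes>\<^bsub>G\<^esub> inv\<^bsub>G\<^esub> b"

text \<open>
  The left coadjoint action is given for \<open>\<epsilon> \<otimes> k\<close> and \<open>\<delta>_h \<otimes> e\<close>; since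
  \<open>\<delta>_h \<otimes> k = (\<delta>_h \<otimes> e)(\<epsilon> \<otimes> k)\<close> in \<open>D\<close> (lemma \<open>dbl_factor\<close>), the action of \<open>\<delta>_h \<otimes> k\<close> on \<open>u(a,b)\<close>
  conjugates by \<open>k\<close> and then projects. Lemmas \<open>coadj_eps\<close> and \<open>coadj_delta\<close> recover the two
  formulas.
\<close>

definition coadj ::
    "('g, 'm) monoid_scheme \<Rightarrow> ('g \<times> 'g \<Rightarrow>\<^sub>0 'k::field) \<Rightarrow> 'g \<times> 'g \<Rightarrow> ('g, 'k) tensors"
  where "coadj G x = (\<lambda>(a, b). lin_ext (\<lambda>(h, k).
    if h = commutator G (inv\<^bsub>G\<^esub> (conj_by G k b)) (conj_by G k a)
    then u (conj_by G k a) (conj_by G k b) else 0) x)"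

lemma dbl_factor:
  assumes "group G" "finite (carrier G)" "h \<in> carrier G" "k \<in> carrier G"
  shows "dbl_mult G (bas (h, \<one>\<^bsub>G\<^esub>)) (dbl_eps G k) = (bas (h, k) :: _ \<Rightarrow>\<^sub>0 'k::field)"
proof -
  interpret group G by fact
  have "dbl_mult G (bas (h, \<one>\<^bsub>G\<^esub>)) (dbl_eps G k)
      = (\<Sum>c\<in>carrier G. if h = c then bas (h, k) else (0 :: _ \<Rightarrow>\<^sub>0 'k))"
    using assms by (auto simp: dbl_mult_def dbl_eps_def lin_ext_sum intro!: sum.cong)
  thus ?thesis using assms by simp
qed

lemma coadj_eps:
  assumes "group G" "finite (carrier G)" "h \<in> carrier G" "a \<in> carrier G" "b \<in> carrier G"
  shows "coadj G (dbl_eps G h) (a, b) = u (conj_by G h a) (conj_by G h b)"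
proof -
  interpret group G by fact
  have "commutator G (inv\<^bsub>G\<^esub> (conj_by G h b)) (conj_by G h a) \<in> carrier G"
    using assms by (simp add: commutator_def conj_by_def)
  thus ?thesis using assms by (simp add: coadj_def dbl_eps_def lin_ext_sum)
qed

lemma coadj_delta:
  assumes "group G" "h \<in> carrier G" "a \<in> carrier G" "b \<in> carrier G"
  shows "coadj G (bas (h, \<one>\<^bsub>G\<^esub>)) (a, b) = (if h = commutator G (inv\<^bsub>G\<^esub> b) a then u a b else 0)"
proof -
  interpret group G by fact
  show ?thesis using assms by (simp add: coadj_def conj_by_def)
qed

text \<open>The action of \<open>D\<close> on \<open>L \<otimes> L\<^sup>\<otimes>\<^sup>n\<close> via the coproduct, and on \<open>L\<^sup>\<otimes>\<^sup>0 = K\<close> via the counit\<close>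

primrec dbl_act_word ::
    "('g, 'm) monoid_scheme \<Rightarrow> ('g \<times> 'g) list \<Rightarrow> ('g \<times> 'g \<Rightarrow>\<^sub>0 'k::field) \<Rightarrow> ('g, 'k) tensors"
  where
    "dbl_act_word G [] = (\<lambda>x. fscale (dbl_counit G x) (bas []))"
  | "dbl_act_word G (y # w) = (\<lambda>x.
       lin_ext (\<lambda>(p, q). tens (coadj G (bas p) y) (dbl_act_word G w (bas q))) (dbl_comult G x))"

definition dbl_act ::
    "('g, 'm) monoid_scheme \<Rightarrow> ('g \<times> 'g \<Rightarrow>\<^sub>0 'k::field) \<Rightarrow> ('g, 'k) tensors \<Rightarrow> ('g, 'k) tensors"
  where "dbl_act G x = lin_ext (\<lambda>w. dbl_act_word G w x)"

definition Ltens_e :: "('g, 'm) monoid_scheme \<Rightarrow> nat \<Rightarrow> ('g, 'k::field) tensors set"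
  where "Ltens_e G n = {w \<in> Ltens G n. dbl_act G (bas (\<one>\<^bsub>G\<^esub>, \<one>\<^bsub>G\<^esub>)) w = w}"

definition T_op :: "('g, 'm) monoid_scheme \<Rightarrow> ('g, 'k::field) tensors \<Rightarrow> ('g, 'k) tensors"
  where "T_op G = lin_ext (\<lambda>w. case w of [(c, d)] \<Rightarrow> u c (c \<otimes>\<^bsub>G\<^esub> d) | _ \<Rightarrow> 0)"

definition S_op :: "('g, 'm) monoid_scheme \<Rightarrow> ('g, 'k::field) tensors \<Rightarrow> ('g, 'k) tensors"
  where "S_op G = lin_ext (\<lambda>w. case w of
      [(c, d)] \<Rightarrow> u d (inv\<^bsub>G\<^esub> d \<otimes>\<^bsub>G\<^esub> inv\<^bsub>G\<^esub> c \<otimes>\<^bsub>G\<^esub> d) | _ \<Rightarrow> 0)"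

definition N_op :: "('g, 'm) monoid_scheme \<Rightarrow> ('g, 'k::field) tensors \<Rightarrow> ('g, 'k) tensors"
  where "N_op G = lin_ext (\<lambda>w. case w of
      [(c, d), (c', d')] \<Rightarrow>
        (let n = inv\<^bsub>G\<^esub> c' \<otimes>\<^bsub>G\<^esub> inv\<^bsub>G\<^esub> d \<otimes>\<^bsub>G\<^esub> c \<otimes>\<^bsub>G\<^esub> d in
          tens (u c (d \<otimes>\<^bsub>G\<^esub> n)) (u (inv\<^bsub>G\<^esub> n \<otimes>\<^bsub>G\<^esub> c' \<otimes>\<^bsub>G\<^esub> n) (inv\<^bsub>G\<^esub> n \<otimes>\<^bsub>G\<^esub> d')))
    | _ \<Rightarrow> 0)"


section \<open>Smooth maps and closed oriented surfaces\<close>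

type_synonym pt = "real ^ 3"

text \<open>\<open>C\<^sup>k\<close> and \<open>C\<^sup>\<infinity>\<close> maps on an open subset of a finite-dimensional space\<close>

primrec Ck_on ::
    "nat \<Rightarrow> 'a::euclidean_space set \<Rightarrow> ('a \<Rightarrow> 'b::euclidean_space) \<Rightarrow> bool"
  where
    "Ck_on 0 U = (\<lambda>f. continuous_on U f)"
  | "Ck_on (Suc k) U = (\<lambda>f. \<exists>f'. (\<forall>x\<in>U. (f has_derivative f' x) (at x)) \<and>
                                (\<forall>v. Ck_on k U (\<lambda>x. f' x v)))"

definition Cinf_on :: "'a::euclidean_space set \<Rightarrow> ('a \<Rightarrow> 'b::euclidean_space) \<Rightarrow> bool"
  where "Cinf_on U f \<longleftrightarrow> open U \<and> (\<forall>k. Ck_on k U f)"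

text \<open>Smoothness on an arbitrary subset: local existence of smooth extensions\<close>

definition smooth_map :: "'a::euclidean_space set \<Rightarrow> ('a \<Rightarrow> 'b::euclidean_space) \<Rightarrow> bool"
  where "smooth_map A f \<longleftrightarrow>
    (\<forall>p\<in>A. \<exists>U F. p \<in> U \<and> Cinf_on U F \<and> (\<forall>y\<in>A \<inter> U. F y = f y))"

definition tangent_space :: "pt set \<Rightarrow> pt \<Rightarrow> pt set"
  where "tangent_space S p =
    {v. \<exists>c e. e > 0 \<and> Cinf_on {-e<..<e::real} c \<and> c ` {-e<..<e} \<subseteq> S \<and> c 0 = p \<and>
              (c has_vector_derivative v) (at 0)}"

text \<open>
  Every closed oriented surface embeds smoothly into \<open>\<real>\<^sup>3\<close>, so the surface \<open>S\<close> is taken to be a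
  compact connected subset of \<open>\<real>\<^sup>3\<close> that is locally a regular level set; the orientation is given
  by a unit normal field \<open>\<nu>\<close>. The genus is half the rank of \<open>H\<^sub>1(S)\<close>.
\<close>

definition closed_oriented_surface :: "nat \<Rightarrow> pt set \<Rightarrow> (pt \<Rightarrow> pt) \<Rightarrow> bool"
  where "closed_oriented_surface g S \<nu> \<longleftrightarrow>
    S \<noteq> {} \<and> compact S \<and> connected S \<and>
    (\<forall>p\<in>S. \<exists>U F F'. p \<in> U \<and> Cinf_on U (F :: pt \<Rightarrow> real) \<and> S \<inter> U = {y \<in> U. F y = 0} \<and>
                     (F has_derivative F') (at p) \<and> F' \<noteq> (\<lambda>_. 0)) \<and>
    continuous_on S \<nu> \<and>
    (\<forall>p\<in>S. norm (\<nu> p) = 1 \<and> (\<forall>v\<in>tangent_space S p. \<nu> p \<bullet> v = 0)) \<and>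
    homology_group 1 (top_of_set S) \<cong> free_Abelian_group {..<2 * g}"

text \<open>
  A tangent basis \<open>(v, w)\<close> at \<open>p\<close> is positive iff \<open>\<nu> p \<bullet> (v \<times> w) > 0\<close>. The restriction of \<open>F'\<close> to
  the tangent space is the differential of \<open>\<phi>\<close> and does not depend on the local extension \<open>F\<close>.
\<close>

definition orientation_preserving :: "pt set \<Rightarrow> (pt \<Rightarrow> pt) \<Rightarrow> (pt \<Rightarrow> pt) \<Rightarrow> bool"
  where "orientation_preserving S \<nu> \<phi> \<longleftrightarrow>
    (\<forall>p\<in>S. \<exists>U F F'. p \<in> U \<and> Cinf_on U F \<and> (\<forall>y\<in>S \<inter> U. F y = \<phi> y) \<and>
       (F has_derivative F') (at p) \<and>
       (\<forall>v\<in>tangent_space S p. \<forall>w\<in>tangent_space S p.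
          \<nu> p \<bullet> cross3 v w > 0 \<longleftrightarrow> \<nu> (\<phi> p) \<bullet> cross3 (F' v) (F' w) > 0))"

text \<open>The values of a diffeomorphism outside \<open>S\<close> are irrelevant; they disappear in isotopy classes.\<close>

definition diffeos :: "pt set \<Rightarrow> (pt \<Rightarrow> pt) \<Rightarrow> pt \<Rightarrow> (pt \<Rightarrow> pt) set"
  where "diffeos S \<nu> x =
    {\<phi>. bij_betw \<phi> S S \<and> smooth_map S \<phi> \<and> smooth_map S (inv_into S \<phi>) \<and>
        orientation_preserving S \<nu> \<phi> \<and> \<phi> x = x}"

definition isotopic :: "pt set \<Rightarrow> (pt \<Rightarrow> pt) \<Rightarrow> pt \<Rightarrow> (pt \<Rightarrow> pt) \<Rightarrow> (pt \<Rightarrow> pt) \<Rightarrow> bool"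
  where "isotopic S \<nu> x \<phi> \<psi> \<longleftrightarrow>
    (\<exists>H :: pt \<times> real \<Rightarrow> pt. smooth_map (S \<times> {0..1}) H \<and>
       (\<forall>t\<in>{0..1}. (\<lambda>p. H (p, t)) \<in> diffeos S \<nu> x) \<and>
       (\<forall>p\<in>S. H (p, 0) = \<phi> p \<and> H (p, 1) = \<psi> p))"

definition isotopy_class :: "pt set \<Rightarrow> (pt \<Rightarrow> pt) \<Rightarrow> pt \<Rightarrow> (pt \<Rightarrow> pt) \<Rightarrow> (pt \<Rightarrow> pt) set"
  where "isotopy_class S \<nu> x \<phi> = {\<psi> \<in> diffeos S \<nu> x. isotopic S \<nu> x \<phi> \<psi>}"

definition mapping_class_group :: "pt set \<Rightarrow> (pt \<Rightarrow> pt) \<Rightarrow> pt \<Rightarrow> (pt \<Rightarrow> pt) set monoid"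
  where "mapping_class_group S \<nu> x =
    \<lparr>carrier = isotopy_class S \<nu> x ` diffeos S \<nu> x,
     monoid.mult = (\<lambda>A B. \<Union>\<phi>\<in>A. \<Union>\<psi>\<in>B. isotopy_class S \<nu> x (\<phi> \<circ> \<psi>)),
     one = isotopy_class S \<nu> x id\<rparr>"


section \<open>The fundamental group\<close>

definition loops :: "pt set \<Rightarrow> pt \<Rightarrow> (real \<Rightarrow> pt) set"
  where "loops S x = {\<gamma>. path \<gamma> \<and> path_image \<gamma> \<subseteq> S \<and> pathstart \<gamma> = x \<and> pathfinish \<gamma> = x}"

definition loop_class :: "pt set \<Rightarrow> (real \<Rightarrow> pt) \<Rightarrow> (real \<Rightarrow> pt) set"
  where "loop_class S \<gamma> = {\<eta>. homotopic_paths S \<gamma> \<eta>}"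

definition fundamental_group :: "pt set \<Rightarrow> pt \<Rightarrow> (real \<Rightarrow> pt) set monoid"
  where "fundamental_group S x =
    \<lparr>carrier = loop_class S ` loops S x,
     monoid.mult = (\<lambda>A B. \<Union>\<gamma>\<in>A. \<Union>\<eta>\<in>B. loop_class S (\<gamma> +++ \<eta>)),
     one = loop_class S (linepath x x)\<rparr>"

definition mcg_act :: "pt set \<Rightarrow> (pt \<Rightarrow> pt) set \<Rightarrow> (real \<Rightarrow> pt) set \<Rightarrow> (real \<Rightarrow> pt) set"
  where "mcg_act S \<Psi> C = (\<Union>\<psi>\<in>\<Psi>. \<Union>\<gamma>\<in>C. loop_class S (\<psi> \<circ> \<gamma>))"


section \<open>Presentations\<close>

text \<open>A letter \<open>(i, True)\<close> stands for the generator \<open>i\<close>, \<open>(i, False)\<close> for its inverse.\<close>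

primrec word_val :: "('p, 'm) monoid_scheme \<Rightarrow> ('i \<Rightarrow> 'p) \<Rightarrow> ('i \<times> bool) list \<Rightarrow> 'p"
  where
    "word_val P f [] = \<one>\<^bsub>P\<^esub>"
  | "word_val P f (l # w) =
      (if snd l then f (fst l) else inv\<^bsub>P\<^esub> (f (fst l))) \<otimes>\<^bsub>P\<^esub> word_val P f w"

inductive word_equiv :: "'i set \<Rightarrow> ('i \<times> bool) list set \<Rightarrow> ('i \<times> bool) list \<Rightarrow> ('i \<times> bool) list \<Rightarrow> bool"
  for I R where
    word_refl: "word_equiv I R w w"
  | word_sym: "word_equiv I R v w \<Longrightarrow> word_equiv I R w v"
  | word_trans: "word_equiv I R v w \<Longrightarrow> word_equiv I R w z \<Longrightarrow> word_equiv I R v z"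
  | word_cancel: "i \<in> I \<Longrightarrow> word_equiv I R (v @ [(i, s), (i, \<not> s)] @ w) (v @ w)"
  | word_rel: "r \<in> R \<Longrightarrow> word_equiv I R (v @ r @ w) (v @ w)"

definition presented_by ::
    "('p, 'm) monoid_scheme \<Rightarrow> 'i set \<Rightarrow> ('i \<Rightarrow> 'p) \<Rightarrow> ('i \<times> bool) list set \<Rightarrow> bool"
  where "presented_by P I f R \<longleftrightarrow>
    f ` I \<subseteq> carrier P \<and>
    carrier P = word_val P f ` lists (I \<times> UNIV) \<and>
    (\<forall>v\<in>lists (I \<times> UNIV). \<forall>w\<in>lists (I \<times> UNIV).
       word_val P f v = word_val P f w \<longleftrightarrow> word_equiv I R v w)"

datatype handle_gen = Alpha nat | Beta nat

definition handle_gens :: "nat \<Rightarrow> handle_gen set"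
  where "handle_gens g = Alpha ` {1..g} \<union> Beta ` {1..g}"

definition surface_relator :: "nat \<Rightarrow> (handle_gen \<times> bool) list"
  where "surface_relator g = concat (map (\<lambda>i.
    [(Alpha i, True), (Beta i, True), (Alpha i, False), (Beta i, False)]) [1..<Suc g])"

definition marked_surface ::
    "nat \<Rightarrow> pt set \<Rightarrow> (pt \<Rightarrow> pt) \<Rightarrow> pt \<Rightarrow> (nat \<Rightarrow> real \<Rightarrow> pt) \<Rightarrow> (nat \<Rightarrow> real \<Rightarrow> pt) \<Rightarrow> bool"
  where "marked_surface g S \<nu> x \<alpha> \<beta> \<longleftrightarrow>
    closed_oriented_surface g S \<nu> \<and> x \<in> S \<and>
    (\<forall>i\<in>{1..g}. \<alpha> i \<in> loops S x \<and> \<beta> i \<in> loops S x) \<and>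
    presented_by (fundamental_group S x) (handle_gens g)
      (case_handle_gen (\<lambda>i. loop_class S (\<alpha> i)) (\<lambda>i. loop_class S (\<beta> i)))
      {surface_relator g}"

text \<open>
  The generators of the mapping class group and their action on the fundamental group. For
  \<open>g = 0\<close> the three families are empty and the last condition says that the group is trivial.
\<close>

definition mcg_generators ::
    "nat \<Rightarrow> pt set \<Rightarrow> (pt \<Rightarrow> pt) \<Rightarrow> pt \<Rightarrow> (nat \<Rightarrow> real \<Rightarrow> pt) \<Rightarrow> (nat \<Rightarrow> real \<Rightarrow> pt) \<Rightarrow>
      (nat \<Rightarrow> (pt \<Rightarrow> pt) set) \<Rightarrow> (nat \<Rightarrow> (pt \<Rightarrow> pt) set) \<Rightarrow> (nat \<Rightarrow> (pt \<Rightarrow> pt) set) \<Rightarrow> bool"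
  where "mcg_generators g S \<nu> x \<alpha> \<beta> t s n \<longleftrightarrow>
    (let \<Gamma> = mapping_class_group S \<nu> x;
         P = fundamental_group S x;
         a = (\<lambda>i. loop_class S (\<alpha> i));
         b = (\<lambda>i. loop_class S (\<beta> i))
     in
      (\<forall>i\<in>{1..g}. t i \<in> carrier \<Gamma> \<and>
         (\<forall>j\<in>{1..g}. mcg_act S (t i) (a j) = a j \<and>
            mcg_act S (t i) (b j) = (if j = i then b i \<otimes>\<^bsub>P\<^esub> a i else b j))) \<and>
      (\<forall>i\<in>{1..g}. s i \<in> carrier \<Gamma> \<and>
         (\<forall>j\<in>{1..g}.
            mcg_act S (s i) (a j) = (if j = i then a i \<otimes>\<^bsub>P\<^esub> b i \<otimes>\<^bsub>P\<^esub> inv\<^bsub>P\<^esub> (a i) else a j) \<and>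
            mcg_act S (s i) (b j) = (if j = i then inv\<^bsub>P\<^esub> (a i) else b j))) \<and>
      (\<forall>l\<in>{1..<g}. n l \<in> carrier \<Gamma> \<and>
         (let m = inv\<^bsub>P\<^esub> (a (l + 1)) \<otimes>\<^bsub>P\<^esub> b l \<otimes>\<^bsub>P\<^esub> a l \<otimes>\<^bsub>P\<^esub> inv\<^bsub>P\<^esub> (b l) in
          (\<forall>j\<in>{1..g}.
            mcg_act S (n l) (a j) =
              (if j = l + 1 then m \<otimes>\<^bsub>P\<^esub> a (l + 1) \<otimes>\<^bsub>P\<^esub> inv\<^bsub>P\<^esub> m else a j) \<and>
            mcg_act S (n l) (b j) =
              (if j = l then m \<otimes>\<^bsub>P\<^esub> b l
               else if j = l + 1 then b (l + 1) \<otimes>\<^bsub>P\<^esub> inv\<^bsub>P\<^esub> m else b j)))) \<and>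
      generate \<Gamma> (t ` {1..g} \<union> s ` {1..g} \<union> n ` {1..<g}) = carrier \<Gamma>)"


section \<open>The two modules and the map between them\<close>

text \<open>
  Homomorphisms are made extensional, so that each is represented by exactly one HOL function.
\<close>

definition rep_variety :: "pt set \<Rightarrow> pt \<Rightarrow> ('g, 'm) monoid_scheme \<Rightarrow> ((real \<Rightarrow> pt) set \<Rightarrow> 'g) set"
  where "rep_variety S x G =
    hom (fundamental_group S x) G \<inter> extensional (carrier (fundamental_group S x))"

definition rep_space ::
    "pt set \<Rightarrow> pt \<Rightarrow> ('g, 'm) monoid_scheme \<Rightarrow> (((real \<Rightarrow> pt) set \<Rightarrow> 'g) \<Rightarrow>\<^sub>0 'k::field) set"
  where "rep_space S x G = free_space (rep_variety S x G)"

definition rep_act ::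
    "pt set \<Rightarrow> (pt \<Rightarrow> pt) \<Rightarrow> pt \<Rightarrow> (pt \<Rightarrow> pt) set \<Rightarrow>
      (((real \<Rightarrow> pt) set \<Rightarrow> 'g) \<Rightarrow>\<^sub>0 'k::field) \<Rightarrow> (((real \<Rightarrow> pt) set \<Rightarrow> 'g) \<Rightarrow>\<^sub>0 'k)"
  where "rep_act S \<nu> x \<Psi> =
    lin_ext (\<lambda>f. bas (restrict (\<lambda>C. f (mcg_act S (inv\<^bsub>mapping_class_group S \<nu> x\<^esub> \<Psi>) C))
                              (carrier (fundamental_group S x))))"

text \<open>
  The action of Lyubashenko on \<open>(L\<^sup>\<otimes>\<^sup>g)\<^sub>e\<close> belonging to the R-matrix
  \<open>\<Sum>\<^sub>a\<^sub>b (\<delta>_a \<otimes> e) \<otimes> (\<delta>_b \<otimes> a\<^sup>-\<^sup>1)\<close>, characterised by the operators of the generators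
\<close>

definition lyubashenko_action ::
    "nat \<Rightarrow> pt set \<Rightarrow> (pt \<Rightarrow> pt) \<Rightarrow> pt \<Rightarrow>
      (nat \<Rightarrow> (pt \<Rightarrow> pt) set) \<Rightarrow> (nat \<Rightarrow> (pt \<Rightarrow> pt) set) \<Rightarrow> (nat \<Rightarrow> (pt \<Rightarrow> pt) set) \<Rightarrow>
      ('g, 'm) monoid_scheme \<Rightarrow> ((pt \<Rightarrow> pt) set \<Rightarrow> ('g, 'k::field) tensors \<Rightarrow> ('g, 'k) tensors) \<Rightarrow> bool"
  where "lyubashenko_action g S \<nu> x t s n G \<rho> \<longleftrightarrow>
    group_module (mapping_class_group S \<nu> x) (Ltens_e G g) \<rho> \<and>
    (\<forall>w\<in>Ltens_e G g.
      (\<forall>i\<in>{1..g}. \<rho> (t i) w = tens_op (i - 1) 1 (T_op G) w \<and>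
                  \<rho> (s i) w = tens_op (i - 1) 1 (S_op G) w) \<and>
      (\<forall>l\<in>{1..<g}. \<rho> (n l) w = tens_op (l - 1) 2 (N_op G) w))"

definition Theta ::
    "nat \<Rightarrow> pt set \<Rightarrow> (nat \<Rightarrow> real \<Rightarrow> pt) \<Rightarrow> (nat \<Rightarrow> real \<Rightarrow> pt) \<Rightarrow> ('g, 'm) monoid_scheme \<Rightarrow>
      (((real \<Rightarrow> pt) set \<Rightarrow> 'g) \<Rightarrow>\<^sub>0 'k::field) \<Rightarrow> ('g, 'k) tensors"
  where "Theta g S \<alpha> \<beta> G =
    lin_ext (\<lambda>f. tens_list (map (\<lambda>i.
      u (f (loop_class S (\<alpha> i))) (inv\<^bsub>G\<^esub> (f (loop_class S (\<beta> i))))) [1..<Suc g]))"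

end

theory Submission
  imports Defs
begin

text \<open>
  In coordinates both sides are free on the same set. A representation \<open>f\<close> is determined by the
  values \<open>a\<^sub>i, b\<^sub>i\<close> of the generators, and these values are arbitrary subject to
  \<open>[a\<^sub>1, b\<^sub>1] \<cdots> [a\<^sub>g, b\<^sub>g] = e\<close>. On the other side, \<open>\<delta>_e \<otimes> e\<close> acts on the tensor
  \<open>u(c\<^sub>1, d\<^sub>1) \<otimes> \<dots> \<otimes> u(c\<^sub>g, d\<^sub>g)\<close> as the identity or as zero according to whether the product
  \<open>[d\<^sub>g\<^sup>-\<^sup>1, c\<^sub>g] \<cdots> [d\<^sub>1\<^sup>-\<^sup>1, c\<^sub>1]\<close>, its grade, is trivial (\<open>dbl_act_word_delta\<close>). For \<open>c\<^sub>i = a\<^sub>i\<close> and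
  \<open>d\<^sub>i = b\<^sub>i\<^sup>-\<^sup>1\<close> the grade is the inverse of the product of commutators above
  (\<open>grade_handles\<close>). So \<open>\<Theta>\<close> is the linear extension of a bijection of bases
  (\<open>bij_betw_handle_word\<close>).

  The mapping class \<open>[\<psi>]\<close> sends \<open>f\<close> to \<open>f' = f \<circ> \<psi>\<^sub>*\<^sup>-\<^sup>1\<close>, hence \<open>f = f' \<circ> \<psi>\<^sub>*\<close>. For each of the
  generators this expresses the values of \<open>f\<close> through those of \<open>f'\<close>, and inserting them into the
  operator on tensors returns the tensor of \<open>f'\<close> (\<open>T_op_handle_word\<close>, \<open>S_op_handle_word\<close>,
  \<open>N_op_handle_word\<close>). The action on representations, transported along \<open>\<Theta>\<close>, therefore is an
  action with the prescribed operators, which gives existence; and \<open>\<Theta>\<close> intertwines any action with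
  these operators with the one on representations, because it does so on generators
  (\<open>equivariant_if_on_generators\<close>).

  All this presupposes that isotopy classes of diffeomorphisms form a group that acts on the
  fundamental group. The analytic input is the chain rule: smooth maps compose, derivatives of
  local extensions respect tangent vectors, and so orientation-preserving diffeomorphisms are
  closed under composition and inversion.
\<close>

section \<open>Calculus of smooth maps\<close>

lemma Ck_on_continuous: "Ck_on k U f \<Longrightarrow> continuous_on U f"
proof (cases k)
  case (Suc k')
  assume "Ck_on k U f"
  then show ?thesis
    unfolding Suc by (auto intro!: continuous_at_imp_continuous_on dest: has_derivative_continuous)
qed simp

lemma Ck_on_subset: "Ck_on k U f \<Longrightarrow> V \<subseteq> U \<Longrightarrow> Ck_on k V f"
proof (induction k arbitrary: f)
  case 0
  then show ?case by (auto intro: continuous_on_subset)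
next
  case (Suc k)
  then obtain f' where "\<forall>x\<in>U. (f has_derivative f' x) (at x)" "\<forall>v. Ck_on k U (\<lambda>x. f' x v)"
    by auto
  with Suc show ?case by (auto intro!: exI[of _ f'])
qed

lemma Ck_on_Suc_imp: "Ck_on (Suc k) U f \<Longrightarrow> Ck_on k U f"
proof (induction k arbitrary: f)
  case 0
  then show ?case using Ck_on_continuous[OF 0] by simp
next
  case (Suc k)
  from Suc.prems obtain f' where "\<forall>x\<in>U. (f has_derivative f' x) (at x)"
    "\<forall>v. Ck_on (Suc k) U (\<lambda>x. f' x v)"
    by (auto simp del: Ck_on.simps simp: Ck_on.simps(2)[of "Suc k"])
  with Suc.IH show ?case
    unfolding Ck_on.simps(2)[of k] by blast
qed

lemma Ck_on_const: "Ck_on k U (\<lambda>x. c)"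
proof (induction k arbitrary: c)
  case (Suc k)
  then show ?case by (auto intro!: exI[of _ "\<lambda>x v. 0"])
qed auto

lemma Ck_on_add: "Ck_on k U f \<Longrightarrow> Ck_on k U g \<Longrightarrow> Ck_on k U (\<lambda>x. f x + g x)"
proof (induction k arbitrary: f g)
  case 0
  then show ?case by (auto intro: continuous_on_add)
next
  case (Suc k)
  from Suc.prems obtain f' g' where
    "\<forall>x\<in>U. (f has_derivative f' x) (at x)" "\<forall>v. Ck_on k U (\<lambda>x. f' x v)"
    "\<forall>x\<in>U. (g has_derivative g' x) (at x)" "\<forall>v. Ck_on k U (\<lambda>x. g' x v)"
    by auto
  with Suc.IH show ?case
    by (auto intro!: exI[of _ "\<lambda>x v. f' x v + g' x v"] has_derivative_add)
qed

lemma Ck_on_sum: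
  "(\<And>i. i \<in> I \<Longrightarrow> Ck_on k U (f i)) \<Longrightarrow> Ck_on k U (\<lambda>x. \<Sum>i\<in>I. f i x)"
proof (induction I rule: infinite_finite_induct)
  case (infinite A)
  then show ?case by (simp add: Ck_on_const del: Ck_on.simps)
next
  case empty
  then show ?case by (simp add: Ck_on_const del: Ck_on.simps)
next
  case (insert i I)
  then show ?case by (simp add: Ck_on_add del: Ck_on.simps)
qed

lemma Ck_on_bounded_linear:
  assumes L: "bounded_linear L"
  shows "Ck_on k U f \<Longrightarrow> Ck_on k U (\<lambda>x. L (f x))"
proof (induction k arbitrary: f)
  case 0
  then show ?case by (auto intro: bounded_linear.continuous_on[OF L])
next
  case (Suc k)
  from Suc.prems obtain f' where
    "\<forall>x\<in>U. (f has_derivative f' x) (at x)" "\<forall>v. Ck_on k U (\<lambda>x. f' x v)"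
    by auto
  with Suc.IH show ?case
    by (auto intro!: exI[of _ "\<lambda>x v. L (f' x v)"] bounded_linear.has_derivative[OF L])
qed

lemma Ck_on_scaleR:
  fixes f :: "'a::euclidean_space \<Rightarrow> real" and g :: "'a \<Rightarrow> 'b::euclidean_space"
  shows "Ck_on k U f \<Longrightarrow> Ck_on k U g \<Longrightarrow> Ck_on k U (\<lambda>x. f x *\<^sub>R g x)"
proof (induction k arbitrary: f g)
  case 0
  then show ?case by (auto intro: continuous_on_scaleR)
next
  case (Suc k)
  note low = Ck_on_Suc_imp[OF Suc.prems(1)] Ck_on_Suc_imp[OF Suc.prems(2)]
  from Suc.prems obtain f' g' where d:
    "\<forall>x\<in>U. (f has_derivative f' x) (at x)" "\<forall>v. Ck_on k U (\<lambda>x. f' x v)"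
    "\<forall>x\<in>U. (g has_derivative g' x) (at x)" "\<forall>v. Ck_on k U (\<lambda>x. g' x v)"
    by auto
  have "Ck_on k U (\<lambda>x. f x *\<^sub>R g' x v + f' x v *\<^sub>R g x)" for v
    by (intro Ck_on_add Suc.IH) (use low d in auto)
  with d show ?case
    by (auto intro!: exI[of _ "\<lambda>x v. f x *\<^sub>R g' x v + f' x v *\<^sub>R g x"] has_derivative_scaleR)
qed

lemma Ck_on_ident: "Ck_on k U (\<lambda>x. x)"
proof (cases k)
  case (Suc k')
  then show ?thesis using Ck_on_const by (auto intro!: exI[of _ "\<lambda>x v. v"])
qed auto

lemma Ck_on_Pair: "Ck_on k U f \<Longrightarrow> Ck_on k U g \<Longrightarrow> Ck_on k U (\<lambda>x. (f x, g x))"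
proof (induction k arbitrary: f g)
  case 0
  then show ?case by (auto intro: continuous_on_Pair)
next
  case (Suc k)
  from Suc.prems obtain f' g' where
    "\<forall>x\<in>U. (f has_derivative f' x) (at x)" "\<forall>v. Ck_on k U (\<lambda>x. f' x v)"
    "\<forall>x\<in>U. (g has_derivative g' x) (at x)" "\<forall>v. Ck_on k U (\<lambda>x. g' x v)"
    by auto
  with Suc.IH show ?case
    by (auto intro!: exI[of _ "\<lambda>x v. (f' x v, g' x v)"] has_derivative_Pair)
qed

text \<open>
  By the chain rule the directional derivative of \<open>g \<circ> f\<close> along \<open>v\<close> is \<open>g' (f x) (f' x v)\<close>.
  Here the direction in which \<open>g\<close> is differentiated varies with \<open>x\<close>, whereas \<open>Ck_on\<close> only
  controls fixed directions; expanding \<open>f' x v\<close> in the standard basis repairs this.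
\<close>

lemma Ck_on_compose:
  "Ck_on k V g \<Longrightarrow> Ck_on k U f \<Longrightarrow> f ` U \<subseteq> V \<Longrightarrow> Ck_on k U (\<lambda>x. g (f x))"
proof (induction k arbitrary: g)
  case 0
  then show ?case using continuous_on_compose2 by auto
next
  case (Suc k)
  have low: "Ck_on k U f" by (rule Ck_on_Suc_imp) fact
  from Suc.prems obtain f' g' where d:
    "\<forall>x\<in>U. (f has_derivative f' x) (at x)" "\<forall>v. Ck_on k U (\<lambda>x. f' x v)"
    "\<forall>x\<in>V. (g has_derivative g' x) (at x)" "\<forall>v. Ck_on k V (\<lambda>x. g' x v)"
    by auto
  let ?h = "\<lambda>x v. \<Sum>b\<in>Basis. (f' x v \<bullet> b) *\<^sub>R g' (f x) b"
  have "Ck_on k U (\<lambda>x. ?h x v)" for v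
    by (intro Ck_on_sum Ck_on_scaleR Suc.IH Ck_on_bounded_linear[OF bounded_linear_inner_left])
       (use low d Suc.prems in auto)
  moreover have "((\<lambda>x. g (f x)) has_derivative ?h x) (at x)" if "x \<in> U" for x
  proof -
    have g: "(g has_derivative g' (f x)) (at (f x))" and f: "(f has_derivative f' x) (at x)"
      using d Suc.prems(3) that by auto
    interpret g': bounded_linear "g' (f x)" by (rule has_derivative_bounded_linear) fact
    have "g' (f x) (f' x v) = ?h x v" for v
      by (subst euclidean_representation[symmetric, of "f' x v"])
         (simp only: g'.sum g'.scaleR)
    then have "(\<lambda>v. g' (f x) (f' x v)) = ?h x" by auto
    with has_derivative_compose[OF f g] show ?thesis by simp
  qed
  ultimately show ?case
    unfolding Ck_on.simps(2) by (intro exI[of _ ?h] conjI ballI allI)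
qed

lemma Cinf_on_subset: "Cinf_on U f \<Longrightarrow> V \<subseteq> U \<Longrightarrow> open V \<Longrightarrow> Cinf_on V f"
  unfolding Cinf_on_def by (metis Ck_on_subset)

lemma Cinf_on_continuous: "Cinf_on U f \<Longrightarrow> continuous_on U f"
  unfolding Cinf_on_def by (elim conjE allE) (rule Ck_on_continuous)

lemma Cinf_on_has_derivative:
  assumes "Cinf_on U f" "p \<in> U"
  obtains f' where "(f has_derivative f') (at p)"
proof -
  have "Ck_on (Suc 0) U f" using assms(1) unfolding Cinf_on_def by (elim conjE allE)
  then show ?thesis using assms(2) that by auto
qed

lemma Cinf_on_ident: "Cinf_on UNIV (\<lambda>x. x)"
  unfolding Cinf_on_def by (intro conjI allI open_UNIV Ck_on_ident)

lemma Cinf_on_bounded_linear: "bounded_linear L \<Longrightarrow> Cinf_on UNIV L"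
  unfolding Cinf_on_def by (intro conjI allI open_UNIV Ck_on_bounded_linear[OF _ Ck_on_ident])

lemma Cinf_on_compose:
  assumes "Cinf_on V g" "Cinf_on U f" "f ` U \<subseteq> V"
  shows "Cinf_on U (\<lambda>x. g (f x))"
  unfolding Cinf_on_def
proof (intro conjI allI)
  show "open U" using assms(2) unfolding Cinf_on_def by (rule conjunct1)
  fix k
  show "Ck_on k U (\<lambda>x. g (f x))"
    using assms unfolding Cinf_on_def by (intro Ck_on_compose[of k V g U f]) simp_all
qed

lemma open_preimage_Cinf_on:
  assumes "Cinf_on U F" "open V"
  shows "open (U \<inter> F -` V)"
  using continuous_open_preimage[OF Cinf_on_continuous[OF assms(1)] _ assms(2)] assms(1)
  by (simp add: Cinf_on_def)

lemma Cinf_on_compose_preimage: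
  assumes F: "Cinf_on U F" and G: "Cinf_on V G"
  shows "Cinf_on (U \<inter> F -` V) (\<lambda>y. G (F y))"
proof (rule Cinf_on_compose[OF G])
  have "open V" using G by (simp add: Cinf_on_def)
  then show "Cinf_on (U \<inter> F -` V) F"
    by (intro Cinf_on_subset[OF F] open_preimage_Cinf_on[OF F]) auto
qed auto

lemma smooth_mapE:
  assumes "smooth_map A f" "p \<in> A"
  obtains U F where "p \<in> U" "Cinf_on U F" "\<And>y. y \<in> A \<Longrightarrow> y \<in> U \<Longrightarrow> F y = f y"
proof -
  from assms have "\<exists>U F. p \<in> U \<and> Cinf_on U F \<and> (\<forall>y\<in>A \<inter> U. F y = f y)"
    unfolding smooth_map_def by (rule bspec)
  then show thesis using that by (elim exE conjE) simp
qed

lemma smooth_map_compose: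
  assumes f: "smooth_map A f" and g: "smooth_map B g" and AB: "f ` A \<subseteq> B"
  shows "smooth_map A (\<lambda>x. g (f x))"
  unfolding smooth_map_def
proof
  fix p assume p: "p \<in> A"
  obtain U F where U: "p \<in> U" "Cinf_on U F" "\<And>y. y \<in> A \<Longrightarrow> y \<in> U \<Longrightarrow> F y = f y"
    using smooth_mapE[OF f p] by blast
  obtain V G where V: "f p \<in> V" "Cinf_on V G" "\<And>y. y \<in> B \<Longrightarrow> y \<in> V \<Longrightarrow> G y = g y"
    using smooth_mapE[OF g, of "f p"] p AB by blast
  show "\<exists>U F. p \<in> U \<and> Cinf_on U F \<and> (\<forall>y\<in>A \<inter> U. F y = g (f y))"
    by (rule exI[of _ "U \<inter> F -` V"], rule exI[of _ "\<lambda>y. G (F y)"])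
       (use U V p AB Cinf_on_compose_preimage[OF U(2) V(2)] in auto)
qed

lemma smooth_map_Pair:
  assumes f: "smooth_map A f" and g: "smooth_map A g"
  shows "smooth_map A (\<lambda>x. (f x, g x))"
  unfolding smooth_map_def
proof
  fix p assume p: "p \<in> A"
  obtain U F where U: "p \<in> U" "Cinf_on U F" "\<And>y. y \<in> A \<Longrightarrow> y \<in> U \<Longrightarrow> F y = f y"
    using smooth_mapE[OF f p] by blast
  obtain V G where V: "p \<in> V" "Cinf_on V G" "\<And>y. y \<in> A \<Longrightarrow> y \<in> V \<Longrightarrow> G y = g y"
    using smooth_mapE[OF g p] by blast
  have "Cinf_on (U \<inter> V) (\<lambda>x. (F x, G x))"
    using U V by (auto simp: Cinf_on_def intro!: Ck_on_Pair intro: Ck_on_subset)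
  with U V show "\<exists>U F. p \<in> U \<and> Cinf_on U F \<and> (\<forall>y\<in>A \<inter> U. F y = (f y, g y))"
    by (intro exI[of _ "U \<inter> V"] exI[of _ "\<lambda>x. (F x, G x)"]) auto
qed

lemma smooth_map_Cinf_on: "Cinf_on UNIV f \<Longrightarrow> smooth_map A f"
  unfolding smooth_map_def by (intro ballI exI[of _ UNIV] exI[of _ f]) simp

lemma smooth_map_cong: "(\<And>x. x \<in> A \<Longrightarrow> f x = g x) \<Longrightarrow> smooth_map A f \<longleftrightarrow> smooth_map A g"
  unfolding smooth_map_def by simp

lemma smooth_map_fst: "smooth_map A fst" and smooth_map_snd: "smooth_map A snd"
  by (simp_all add: smooth_map_Cinf_on Cinf_on_bounded_linear bounded_linear_fst bounded_linear_snd)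

lemma smooth_map_continuous:
  assumes "smooth_map A f" shows "continuous_on A f"
proof -
  have "continuous (at p within A) f" if p: "p \<in> A" for p
  proof -
    obtain U F where U: "p \<in> U" "Cinf_on U F" "\<And>y. y \<in> A \<Longrightarrow> y \<in> U \<Longrightarrow> F y = f y"
      using smooth_mapE[OF assms p] by blast
    have "open U" using U by (simp add: Cinf_on_def)
    have "continuous (at p) F"
      using Cinf_on_continuous[OF U(2)] \<open>open U\<close> U(1) by (simp add: continuous_on_eq_continuous_at)
    then have "(F \<longlongrightarrow> f p) (at p within A)"
      using U p by (metis IntI continuous_at_imp_continuous_at_within continuous_within)
    moreover have "\<forall>\<^sub>F y in at p within A. F y = f y"
      using U \<open>open U\<close> unfolding eventually_at_topological by blast
    ultimately show ?thesis
      unfolding continuous_within by (rule Lim_transform_eventually)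
  qed
  then show ?thesis by (simp add: continuous_on_eq_continuous_within)
qed

section \<open>Diffeomorphisms and isotopies\<close>

text \<open>
  The derivative of \<open>F\<close> at \<open>p\<close> acts on velocity vectors by mapping curves. The curve has to be
  restricted to a shorter interval so as to stay in the domain \<open>U\<close> of the local extension.
\<close>

lemma tangent_space_image:
  assumes v: "v \<in> tangent_space S p" and p: "p \<in> U" and F: "Cinf_on U F"
    and into: "\<And>y. y \<in> S \<Longrightarrow> y \<in> U \<Longrightarrow> F y \<in> S" and d: "(F has_derivative F') (at p)"
  shows "F' v \<in> tangent_space S (F p)"
proof -
  from v obtain c e where c: "e > 0" "Cinf_on {-e<..<e::real} c" "c ` {-e<..<e} \<subseteq> S" "c 0 = p"
    "(c has_vector_derivative v) (at 0)"
    unfolding tangent_space_def by blast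
  have "open ({-e<..<e} \<inter> c -` U)"
    using open_preimage_Cinf_on[OF c(2)] F by (simp add: Cinf_on_def)
  moreover have "0 \<in> {-e<..<e} \<inter> c -` U" using c p by simp
  ultimately obtain r where r: "r > 0" "ball 0 r \<subseteq> {-e<..<e} \<inter> c -` U"
    by (meson open_contains_ball)
  have ball: "ball 0 r = {-r<..<r}" by (auto simp: ball_def)
  have "Cinf_on {-r<..<r} c"
    by (rule Cinf_on_subset[OF c(2)]) (use r ball in auto)
  then have "Cinf_on {-r<..<r} (\<lambda>t. F (c t))"
    by (rule Cinf_on_compose[OF F]) (use r ball in auto)
  moreover have "(\<lambda>t. F (c t)) ` {-r<..<r} \<subseteq> S"
    using r ball c(3) into by blast
  moreover have "((\<lambda>t. F (c t)) has_vector_derivative F' v) (at 0)"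
  proof -
    interpret F': bounded_linear F' by (rule has_derivative_bounded_linear) fact
    have "((\<lambda>t. F (c t)) has_derivative (\<lambda>t. F' (t *\<^sub>R v))) (at 0)"
      using has_derivative_compose[of c "\<lambda>t. t *\<^sub>R v" 0 UNIV F F'] c(4,5) d
      by (simp add: has_vector_derivative_def)
    then show ?thesis by (simp add: has_vector_derivative_def F'.scaleR)
  qed
  ultimately show ?thesis
    unfolding tangent_space_def mem_Collect_eq using r(1) c(4)
    by (intro exI[of _ "\<lambda>t. F (c t)"] exI[of _ r]) auto
qed

lemma orientation_preservingE:
  assumes "orientation_preserving S \<nu> \<phi>" "p \<in> S"
  obtains U F F' where "p \<in> U" "Cinf_on U F" "\<forall>y\<in>S \<inter> U. F y = \<phi> y" "(F has_derivative F') (at p)"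
    "\<forall>v\<in>tangent_space S p. \<forall>w\<in>tangent_space S p.
       \<nu> p \<bullet> cross3 v w > 0 \<longleftrightarrow> \<nu> (\<phi> p) \<bullet> cross3 (F' v) (F' w) > 0"
proof -
  have "\<exists>U F F'. p \<in> U \<and> Cinf_on U F \<and> (\<forall>y\<in>S \<inter> U. F y = \<phi> y) \<and> (F has_derivative F') (at p) \<and>
       (\<forall>v\<in>tangent_space S p. \<forall>w\<in>tangent_space S p.
          \<nu> p \<bullet> cross3 v w > 0 \<longleftrightarrow> \<nu> (\<phi> p) \<bullet> cross3 (F' v) (F' w) > 0)"
    using assms unfolding orientation_preserving_def by (rule bspec)
  then show thesis by (elim exE conjE) (rule that)
qed

lemma orientation_preserving_cong:
  "(\<And>p. p \<in> S \<Longrightarrow> \<phi> p = \<psi> p) \<Longrightarrow> orientation_preserving S \<nu> \<phi> \<longleftrightarrow> orientation_preserving S \<nu> \<psi>"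
  unfolding orientation_preserving_def by simp

lemma orientation_preserving_id: "orientation_preserving S \<nu> id"
  unfolding orientation_preserving_def
  by (intro ballI exI[of _ UNIV] exI[of _ "\<lambda>x. x"]) (simp add: Cinf_on_ident)

lemma orientation_preserving_compose:
  assumes \<phi>: "orientation_preserving S \<nu> \<phi>" and \<psi>: "orientation_preserving S \<nu> \<psi>"
    and S: "\<phi> ` S \<subseteq> S"
  shows "orientation_preserving S \<nu> (\<psi> \<circ> \<phi>)"
  unfolding orientation_preserving_def
proof
  fix p assume p: "p \<in> S"
  obtain U F F' where F: "p \<in> U" "Cinf_on U F" "\<forall>y\<in>S \<inter> U. F y = \<phi> y" "(F has_derivative F') (at p)"
    "\<forall>v\<in>tangent_space S p. \<forall>w\<in>tangent_space S p.
       \<nu> p \<bullet> cross3 v w > 0 \<longleftrightarrow> \<nu> (\<phi> p) \<bullet> cross3 (F' v) (F' w) > 0"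
    using orientation_preservingE[OF \<phi> p] by metis
  have Fp: "F p = \<phi> p" "\<phi> p \<in> S" using F p S by auto
  obtain V G G' where G: "\<phi> p \<in> V" "Cinf_on V G" "\<forall>y\<in>S \<inter> V. G y = \<psi> y"
    "(G has_derivative G') (at (\<phi> p))"
    "\<forall>v\<in>tangent_space S (\<phi> p). \<forall>w\<in>tangent_space S (\<phi> p).
       \<nu> (\<phi> p) \<bullet> cross3 v w > 0 \<longleftrightarrow> \<nu> (\<psi> (\<phi> p)) \<bullet> cross3 (G' v) (G' w) > 0"
    using orientation_preservingE[OF \<psi> Fp(2)] by metis
  have tan: "F' v \<in> tangent_space S (\<phi> p)" if "v \<in> tangent_space S p" for v
    using tangent_space_image[OF that F(1,2) _ F(4)] F(3) S Fp by auto
  have der: "((\<lambda>y. G (F y)) has_derivative (\<lambda>v. G' (F' v))) (at p)"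
    using has_derivative_compose[OF F(4), of G G'] G(4) Fp by simp
  show "\<exists>U F F'. p \<in> U \<and> Cinf_on U F \<and> (\<forall>y\<in>S \<inter> U. F y = (\<psi> \<circ> \<phi>) y) \<and>
       (F has_derivative F') (at p) \<and>
       (\<forall>v\<in>tangent_space S p. \<forall>w\<in>tangent_space S p.
          \<nu> p \<bullet> cross3 v w > 0 \<longleftrightarrow> \<nu> ((\<psi> \<circ> \<phi>) p) \<bullet> cross3 (F' v) (F' w) > 0)"
  proof (intro exI conjI)
    show "p \<in> U \<inter> F -` V" using F(1) G(1) Fp by simp
    show "Cinf_on (U \<inter> F -` V) (\<lambda>y. G (F y))" by (rule Cinf_on_compose_preimage) fact+
    show "\<forall>y\<in>S \<inter> (U \<inter> F -` V). G (F y) = (\<psi> \<circ> \<phi>) y" using F(3) G(3) S by auto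
    show "((\<lambda>y. G (F y)) has_derivative (\<lambda>v. G' (F' v))) (at p)" by (rule der)
    show "\<forall>v\<in>tangent_space S p. \<forall>w\<in>tangent_space S p.
       \<nu> p \<bullet> cross3 v w > 0 \<longleftrightarrow> \<nu> ((\<psi> \<circ> \<phi>) p) \<bullet> cross3 (G' (F' v)) (G' (F' w)) > 0"
      using F(5) G(5) tan by simp
  qed
qed

text \<open>
  A local extension of the inverse at \<open>q = \<phi> p\<close> need not be inverse to the extension of \<open>\<phi>\<close> off
  the surface. On tangent vectors the two derivatives are nevertheless inverse to each other, since
  a curve in \<open>S\<close> returns to itself.
\<close>

lemma tangent_derivative_inverse:
  assumes v: "v \<in> tangent_space S q" and G: "q \<in> V" "Cinf_on V G" "(G has_derivative G') (at q)"
    and F: "(F has_derivative F') (at (G q))" and U: "open U" "G q \<in> U"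
    and inv: "\<And>y. y \<in> S \<Longrightarrow> y \<in> V \<Longrightarrow> G y \<in> U \<Longrightarrow> F (G y) = y"
  shows "F' (G' v) = v"
proof -
  from v obtain c e where c: "e > 0" "Cinf_on {-e<..<e::real} c" "c ` {-e<..<e} \<subseteq> S" "c 0 = q"
    "(c has_vector_derivative v) (at 0)"
    unfolding tangent_space_def by blast
  have "open (V \<inter> G -` U)" by (rule open_preimage_Cinf_on[OF G(2) U(1)])
  then have op: "open ({-e<..<e} \<inter> c -` (V \<inter> G -` U))"
    by (rule open_preimage_Cinf_on[OF c(2)])
  have 0: "0 \<in> {-e<..<e} \<inter> c -` (V \<inter> G -` U)" using c G U by simp
  interpret F': bounded_linear F' by (rule has_derivative_bounded_linear) fact
  interpret G': bounded_linear G' by (rule has_derivative_bounded_linear) fact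
  have "((\<lambda>t. G (c t)) has_derivative (\<lambda>t. G' (t *\<^sub>R v))) (at 0)"
    using has_derivative_compose[of c "\<lambda>t. t *\<^sub>R v" 0 UNIV G G'] c(4,5) G(3)
    by (simp add: has_vector_derivative_def)
  from has_derivative_compose[OF this, of F F']
  have "((\<lambda>t. F (G (c t))) has_derivative (\<lambda>t. t *\<^sub>R F' (G' v))) (at 0)"
    using F c(4) by (simp add: F'.scaleR G'.scaleR)
  then have "(c has_derivative (\<lambda>t. t *\<^sub>R F' (G' v))) (at 0)"
    by (rule has_derivative_transform_within_open[OF _ op 0])
       (use c(3) inv in \<open>auto simp: image_subset_iff\<close>)
  then show ?thesis
    using c(5) vector_derivative_unique_at unfolding has_vector_derivative_def[symmetric] by blast
qed

lemma orientation_preserving_inv: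
  assumes bij: "bij_betw \<phi> S S" and \<phi>: "orientation_preserving S \<nu> \<phi>"
    and sm: "smooth_map S (inv_into S \<phi>)"
  shows "orientation_preserving S \<nu> (inv_into S \<phi>)"
  unfolding orientation_preserving_def
proof
  fix q assume q: "q \<in> S"
  let ?p = "inv_into S \<phi> q"
  have p: "?p \<in> S" "\<phi> ?p = q"
    using bij q by (auto simp: bij_betw_def inv_into_into f_inv_into_f)
  obtain U F F' where F: "?p \<in> U" "Cinf_on U F" "\<forall>y\<in>S \<inter> U. F y = \<phi> y" "(F has_derivative F') (at ?p)"
    "\<forall>v\<in>tangent_space S ?p. \<forall>w\<in>tangent_space S ?p.
       \<nu> ?p \<bullet> cross3 v w > 0 \<longleftrightarrow> \<nu> (\<phi> ?p) \<bullet> cross3 (F' v) (F' w) > 0"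
    using orientation_preservingE[OF \<phi> p(1)] by metis
  obtain V G where G: "q \<in> V" "Cinf_on V G" "\<And>y. y \<in> S \<Longrightarrow> y \<in> V \<Longrightarrow> G y = inv_into S \<phi> y"
    using smooth_mapE[OF sm q] by blast
  obtain G' where G': "(G has_derivative G') (at q)"
    using Cinf_on_has_derivative[OF G(2,1)] by blast
  have Gq: "G q = ?p" using G q by simp
  have GS: "G y \<in> S" "\<phi> (G y) = y" if "y \<in> S" "y \<in> V" for y
    using that G(3) bij by (auto simp: bij_betw_def inv_into_into f_inv_into_f)
  have tan: "G' v \<in> tangent_space S ?p" if "v \<in> tangent_space S q" for v
    using tangent_space_image[OF that G(1,2) GS(1) G'] Gq by simp
  have FG: "F' (G' v) = v" if "v \<in> tangent_space S q" for v
  proof (rule tangent_derivative_inverse[OF that G(1,2) G'])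
    show "open U" using F(2) unfolding Cinf_on_def by (rule conjunct1)
    show "F (G y) = y" if "y \<in> S" "y \<in> V" "G y \<in> U" for y
      using that F(3) GS by simp
  qed (use F Gq in auto)
  show "\<exists>U F F'. q \<in> U \<and> Cinf_on U F \<and> (\<forall>y\<in>S \<inter> U. F y = inv_into S \<phi> y) \<and>
       (F has_derivative F') (at q) \<and>
       (\<forall>v\<in>tangent_space S q. \<forall>w\<in>tangent_space S q.
          \<nu> q \<bullet> cross3 v w > 0 \<longleftrightarrow> \<nu> ?p \<bullet> cross3 (F' v) (F' w) > 0)"
    by (intro exI[of _ V] exI[of _ G] exI[of _ G'])
       (use G G' F(5) tan FG p in auto)
qed

lemma diffeosD:
  assumes "\<phi> \<in> diffeos S \<nu> x"
  shows "bij_betw \<phi> S S" "smooth_map S \<phi>" "smooth_map S (inv_into S \<phi>)"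
    "orientation_preserving S \<nu> \<phi>" "\<phi> x = x" "\<phi> ` S \<subseteq> S" "inj_on \<phi> S"
  using assms by (auto simp: diffeos_def bij_betw_def)

lemma diffeos_cong:
  assumes \<phi>: "\<phi> \<in> diffeos S \<nu> x" and eq: "\<And>p. p \<in> S \<Longrightarrow> \<phi> p = \<psi> p" and x: "x \<in> S"
  shows "\<psi> \<in> diffeos S \<nu> x"
proof -
  note D = diffeosD[OF \<phi>]
  have "inv_into S \<phi> y = inv_into S \<psi> y" for y
    unfolding inv_into_def by (rule arg_cong[where f = Eps]) (auto simp: eq)
  then have "inv_into S \<phi> = inv_into S \<psi>" by (rule ext)
  moreover have "bij_betw \<psi> S S" using D(1) bij_betw_cong[of S \<phi> \<psi>] eq by simp
  moreover have "smooth_map S \<psi>" using D(2) smooth_map_cong[of S \<phi> \<psi>] eq by simp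
  moreover have "orientation_preserving S \<nu> \<psi>"
    using D(4) orientation_preserving_cong[of S \<phi> \<psi>] eq by simp
  ultimately show ?thesis using D(3,5) eq[OF x] by (simp add: diffeos_def)
qed

lemma diffeos_id: "id \<in> diffeos S \<nu> x"
proof -
  have *: "smooth_map S (\<lambda>x. x)" by (rule smooth_map_Cinf_on) (rule Cinf_on_ident)
  then have "smooth_map S (inv_into S id)"
    by (subst smooth_map_cong[of S _ "\<lambda>x. x"]) (auto simp: inv_into_f_eq)
  with * show ?thesis by (simp add: diffeos_def orientation_preserving_id id_def[symmetric])
qed

lemma diffeos_comp:
  assumes \<phi>: "\<phi> \<in> diffeos S \<nu> x" and \<psi>: "\<psi> \<in> diffeos S \<nu> x"
  shows "\<psi> \<circ> \<phi> \<in> diffeos S \<nu> x"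
proof -
  note D = diffeosD[OF \<phi>] and E = diffeosD[OF \<psi>]
  have im: "\<phi> ` S = S" "\<psi> ` S = S" using D(1) E(1) by (auto simp: bij_betw_def)
  have "inv_into S (\<psi> \<circ> \<phi>) y = inv_into S \<phi> (inv_into S \<psi> y)" if "y \<in> S" for y
    using inv_into_comp[of \<psi> \<phi> S y] that im D(7) E(7) by simp
  moreover have "smooth_map S (\<lambda>y. inv_into S \<phi> (inv_into S \<psi> y))"
    by (rule smooth_map_compose[OF E(3) D(3)]) (use im in \<open>auto simp: inv_into_into\<close>)
  ultimately have "smooth_map S (inv_into S (\<psi> \<circ> \<phi>))"
    using smooth_map_cong[of S "inv_into S (\<psi> \<circ> \<phi>)"] by simp
  moreover have "smooth_map S (\<psi> \<circ> \<phi>)"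
    using smooth_map_compose[OF D(2) E(2) D(6)] by (simp add: comp_def)
  moreover have "orientation_preserving S \<nu> (\<psi> \<circ> \<phi>)"
    by (rule orientation_preserving_compose) fact+
  ultimately show ?thesis
    using bij_betw_trans[OF D(1) E(1)] D(5) E(5) by (simp add: diffeos_def)
qed

lemma diffeos_inv:
  assumes \<phi>: "\<phi> \<in> diffeos S \<nu> x" and x: "x \<in> S"
  shows "inv_into S \<phi> \<in> diffeos S \<nu> x"
proof -
  note D = diffeosD[OF \<phi>]
  have im: "\<phi> ` S = S" using D(1) by (simp add: bij_betw_def)
  have bij: "bij_betw (inv_into S \<phi>) S S" by (rule bij_betw_inv_into) fact
  have "inv_into S (inv_into S \<phi>) y = \<phi> y" if "y \<in> S" for y
    by (rule inv_into_f_eq) (use bij that D im in \<open>auto simp: bij_betw_def\<close>)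
  then have "smooth_map S (inv_into S (inv_into S \<phi>))"
    using D(2) smooth_map_cong[of S "inv_into S (inv_into S \<phi>)" \<phi>] by simp
  moreover have "inv_into S \<phi> x = x" by (rule inv_into_f_eq) (use D x in auto)
  ultimately show ?thesis
    using bij D(3) orientation_preserving_inv[OF D(1,4,3)] by (simp add: diffeos_def)
qed

lemma isotopic_diffeos:
  assumes "isotopic S \<nu> x \<phi> \<psi>" "x \<in> S"
  shows "\<phi> \<in> diffeos S \<nu> x" "\<psi> \<in> diffeos S \<nu> x"
proof -
  obtain H where H: "\<forall>t\<in>{0..1::real}. (\<lambda>p. H (p, t)) \<in> diffeos S \<nu> x"
    "\<forall>p\<in>S. H (p, 0) = \<phi> p \<and> H (p, 1) = \<psi> p"
    using assms(1) unfolding isotopic_def by (elim exE conjE)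
  have "(\<lambda>p. H (p, 0)) \<in> diffeos S \<nu> x" "(\<lambda>p. H (p, 1)) \<in> diffeos S \<nu> x" using H(1) by auto
  with H(2) assms(2) show "\<phi> \<in> diffeos S \<nu> x" "\<psi> \<in> diffeos S \<nu> x"
    by (auto intro: diffeos_cong)
qed

lemma isotopic_if_eq_on:
  assumes \<phi>: "\<phi> \<in> diffeos S \<nu> x" and eq: "\<And>p. p \<in> S \<Longrightarrow> \<phi> p = \<psi> p"
  shows "isotopic S \<nu> x \<phi> \<psi>"
  unfolding isotopic_def
proof (intro exI conjI)
  show "smooth_map (S \<times> {0..1::real}) (\<lambda>z. \<phi> (fst z))"
    by (rule smooth_map_compose[OF smooth_map_fst diffeosD(2)[OF \<phi>]]) auto
qed (use assms in auto)

lemma isotopic_cong: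
  assumes "isotopic S \<nu> x \<phi> \<psi>" "\<And>p. p \<in> S \<Longrightarrow> \<phi> p = \<phi>' p" "\<And>p. p \<in> S \<Longrightarrow> \<psi> p = \<psi>' p"
  shows "isotopic S \<nu> x \<phi>' \<psi>'"
  using assms unfolding isotopic_def by simp

lemma isotopic_sym:
  assumes "isotopic S \<nu> x \<phi> \<psi>" shows "isotopic S \<nu> x \<psi> \<phi>"
proof -
  obtain H where H: "smooth_map (S \<times> {0..1}) H" "\<forall>t\<in>{0..1::real}. (\<lambda>p. H (p, t)) \<in> diffeos S \<nu> x"
    "\<forall>p\<in>S. H (p, 0) = \<phi> p \<and> H (p, 1) = \<psi> p"
    using assms unfolding isotopic_def by (elim exE conjE)
  have "bounded_linear (\<lambda>z :: pt \<times> real. - snd z)"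
    by (intro bounded_linear_minus bounded_linear_snd)
  then have "Cinf_on UNIV (\<lambda>z :: pt \<times> real. 1 + - snd z)"
    unfolding Cinf_on_def
    by (intro conjI allI open_UNIV Ck_on_add Ck_on_const Ck_on_bounded_linear[OF _ Ck_on_ident])
  then have "smooth_map (S \<times> {0..1}) (\<lambda>z :: pt \<times> real. (fst z, 1 + - snd z))"
    by (intro smooth_map_Pair smooth_map_fst smooth_map_Cinf_on)
  then have "smooth_map (S \<times> {0..1}) (\<lambda>z. H (fst z, 1 + - snd z))"
    by (rule smooth_map_compose[OF _ H(1)]) auto
  with H(2,3) show ?thesis
    unfolding isotopic_def by (intro exI[of _ "\<lambda>z. H (fst z, 1 + - snd z)"]) auto
qed

lemma isotopic_comp:
  assumes \<phi>: "isotopic S \<nu> x \<phi> \<phi>'" and \<psi>: "isotopic S \<nu> x \<psi> \<psi>'"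
  shows "isotopic S \<nu> x (\<phi> \<circ> \<psi>) (\<phi>' \<circ> \<psi>')"
proof -
  obtain H where H: "smooth_map (S \<times> {0..1}) H" "\<forall>t\<in>{0..1::real}. (\<lambda>p. H (p, t)) \<in> diffeos S \<nu> x"
    "\<forall>p\<in>S. H (p, 0) = \<phi> p \<and> H (p, 1) = \<phi>' p"
    using \<phi> unfolding isotopic_def by (elim exE conjE)
  obtain K where K: "smooth_map (S \<times> {0..1}) K" "\<forall>t\<in>{0..1::real}. (\<lambda>p. K (p, t)) \<in> diffeos S \<nu> x"
    "\<forall>p\<in>S. K (p, 0) = \<psi> p \<and> K (p, 1) = \<psi>' p"
    using \<psi> unfolding isotopic_def by (elim exE conjE)
  have KS: "K (p, t) \<in> S" if "p \<in> S" "t \<in> {0..1}" for p t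
    using diffeosD(6)[of "\<lambda>p. K (p, t)" S \<nu> x] K(2) that by auto
  show ?thesis
    unfolding isotopic_def
  proof (intro exI[of _ "\<lambda>z. H (K z, snd z)"] conjI ballI)
    have "smooth_map (S \<times> {0..1}) (\<lambda>z. (K z, snd z))"
      by (intro smooth_map_Pair smooth_map_snd K(1))
    then show "smooth_map (S \<times> {0..1}) (\<lambda>z. H (K z, snd z))"
      by (rule smooth_map_compose[OF _ H(1)]) (use KS in auto)
    fix t :: real assume t: "t \<in> {0..1}"
    then show "(\<lambda>p. H (K (p, t), snd (p, t))) \<in> diffeos S \<nu> x"
      using diffeos_comp[OF bspec[OF K(2) t] bspec[OF H(2) t]] by (simp add: comp_def)
  next
    fix p assume p: "p \<in> S"
    have "K (p, 0) \<in> S" "K (p, 1) \<in> S" using KS[OF p] by auto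
    then show "H (K (p, 0), snd (p, 0)) = (\<phi> \<circ> \<psi>) p" "H (K (p, 1), snd (p, 1)) = (\<phi>' \<circ> \<psi>') p"
      using K(3) H(3) p by auto
  qed
qed

text \<open>
  Concatenating two isotopies in time would require smoothing at the junction. Multiplying them
  in the diffeomorphism group avoids this: if \<open>H\<close> runs from \<open>\<phi>\<close> to \<open>\<psi>\<close> and \<open>K\<close> from \<open>\<psi>\<close> to \<open>\<theta>\<close>,
  then \<open>K\<^sub>t \<circ> \<psi>\<inverse> \<circ> H\<^sub>t\<close> runs from \<open>\<phi>\<close> to \<open>\<theta>\<close>.
\<close>

lemma isotopic_trans:
  assumes \<phi>: "isotopic S \<nu> x \<phi> \<psi>" and \<theta>: "isotopic S \<nu> x \<psi> \<theta>" and x: "x \<in> S"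
  shows "isotopic S \<nu> x \<phi> \<theta>"
proof -
  have \<psi>: "\<psi> \<in> diffeos S \<nu> x" and \<phi>': "\<phi> \<in> diffeos S \<nu> x"
    using isotopic_diffeos[OF \<phi> x] by auto
  have "isotopic S \<nu> x (inv_into S \<psi>) (inv_into S \<psi>)"
    by (rule isotopic_if_eq_on[OF diffeos_inv[OF \<psi> x]]) simp
  then have "isotopic S \<nu> x (\<psi> \<circ> (inv_into S \<psi> \<circ> \<phi>)) (\<theta> \<circ> (inv_into S \<psi> \<circ> \<psi>))"
    by (intro isotopic_comp \<phi> \<theta>)
  then show ?thesis
  proof (rule isotopic_cong)
    fix p assume p: "p \<in> S"
    have "\<psi> ` S = S" "\<phi> p \<in> S" using diffeosD(1)[OF \<psi>] diffeosD(6)[OF \<phi>'] p by (auto simp: bij_betw_def)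
    then show "(\<psi> \<circ> (inv_into S \<psi> \<circ> \<phi>)) p = \<phi> p" by (simp add: f_inv_into_f)
    show "(\<theta> \<circ> (inv_into S \<psi> \<circ> \<psi>)) p = \<theta> p"
      using diffeosD(7)[OF \<psi>] p by simp
  qed
qed

section \<open>The mapping class group\<close>

lemma isotopy_class_self: "\<phi> \<in> diffeos S \<nu> x \<Longrightarrow> \<phi> \<in> isotopy_class S \<nu> x \<phi>"
  by (simp add: isotopy_class_def isotopic_if_eq_on)

lemma isotopy_class_eq:
  assumes "isotopic S \<nu> x \<phi> \<psi>" "x \<in> S"
  shows "isotopy_class S \<nu> x \<phi> = isotopy_class S \<nu> x \<psi>"
proof -
  have "isotopic S \<nu> x \<phi> \<theta> \<longleftrightarrow> isotopic S \<nu> x \<psi> \<theta>" for \<theta>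
  proof
    assume "isotopic S \<nu> x \<phi> \<theta>"
    then show "isotopic S \<nu> x \<psi> \<theta>"
      by (rule isotopic_trans[OF isotopic_sym[OF assms(1)] _ assms(2)])
  next
    assume "isotopic S \<nu> x \<psi> \<theta>"
    then show "isotopic S \<nu> x \<phi> \<theta>" by (rule isotopic_trans[OF assms(1) _ assms(2)])
  qed
  then show ?thesis by (simp add: isotopy_class_def)
qed

lemma mapping_class_group_carrier:
  "carrier (mapping_class_group S \<nu> x) = isotopy_class S \<nu> x ` diffeos S \<nu> x"
  by (simp add: mapping_class_group_def)

lemma mapping_class_group_one: "\<one>\<^bsub>mapping_class_group S \<nu> x\<^esub> = isotopy_class S \<nu> x id"
  by (simp add: mapping_class_group_def)

lemma mapping_class_group_mult:
  assumes x: "x \<in> S" and \<phi>: "\<phi> \<in> diffeos S \<nu> x" and \<psi>: "\<psi> \<in> diffeos S \<nu> x"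
  shows "isotopy_class S \<nu> x \<phi> \<otimes>\<^bsub>mapping_class_group S \<nu> x\<^esub> isotopy_class S \<nu> x \<psi>
    = isotopy_class S \<nu> x (\<phi> \<circ> \<psi>)"
proof -
  let ?A = "isotopy_class S \<nu> x \<phi>" and ?B = "isotopy_class S \<nu> x \<psi>"
  have "isotopy_class S \<nu> x (\<phi>' \<circ> \<psi>') = isotopy_class S \<nu> x (\<phi> \<circ> \<psi>)" if "\<phi>' \<in> ?A" "\<psi>' \<in> ?B" for \<phi>' \<psi>'
  proof (rule isotopy_class_eq[OF isotopic_sym x], rule isotopic_comp)
    show "isotopic S \<nu> x \<phi> \<phi>'" "isotopic S \<nu> x \<psi> \<psi>'"
      using that by (simp_all add: isotopy_class_def)
  qed
  then have "(\<Union>\<phi>'\<in>?A. \<Union>\<psi>'\<in>?B. isotopy_class S \<nu> x (\<phi>' \<circ> \<psi>'))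
      = (\<Union>\<phi>'\<in>?A. \<Union>\<psi>'\<in>?B. isotopy_class S \<nu> x (\<phi> \<circ> \<psi>))"
    by simp
  moreover have "?A \<noteq> {}" "?B \<noteq> {}" using isotopy_class_self \<phi> \<psi> by blast+
  ultimately show ?thesis by (simp add: mapping_class_group_def)
qed

lemma group_mapping_class_group:
  assumes x: "x \<in> S" shows "group (mapping_class_group S \<nu> x)"
proof (rule groupI)
  let ?M = "mapping_class_group S \<nu> x"
  note simps = mapping_class_group_carrier mapping_class_group_one mapping_class_group_mult[OF x]
    diffeos_comp diffeos_id
  show "\<one>\<^bsub>?M\<^esub> \<in> carrier ?M" by (simp add: simps)
  show "A \<otimes>\<^bsub>?M\<^esub> B \<in> carrier ?M" if "A \<in> carrier ?M" "B \<in> carrier ?M" for A B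
    using that by (auto simp: simps)
  show "A \<otimes>\<^bsub>?M\<^esub> B \<otimes>\<^bsub>?M\<^esub> C = A \<otimes>\<^bsub>?M\<^esub> (B \<otimes>\<^bsub>?M\<^esub> C)"
    if "A \<in> carrier ?M" "B \<in> carrier ?M" "C \<in> carrier ?M" for A B C
    using that by (auto simp: simps comp_assoc)
  show "\<one>\<^bsub>?M\<^esub> \<otimes>\<^bsub>?M\<^esub> A = A" if "A \<in> carrier ?M" for A
    using that by (auto simp: simps)
  show "\<exists>B\<in>carrier ?M. B \<otimes>\<^bsub>?M\<^esub> A = \<one>\<^bsub>?M\<^esub>" if A: "A \<in> carrier ?M" for A
  proof -
    from A obtain \<phi> where \<phi>: "\<phi> \<in> diffeos S \<nu> x" and A: "A = isotopy_class S \<nu> x \<phi>"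
      by (auto simp: simps)
    note inv = diffeos_inv[OF \<phi> x]
    have "isotopic S \<nu> x (inv_into S \<phi> \<circ> \<phi>) id"
      by (rule isotopic_if_eq_on[OF diffeos_comp[OF \<phi> inv]]) (simp add: diffeosD(7)[OF \<phi>])
    then have "isotopy_class S \<nu> x (inv_into S \<phi>) \<otimes>\<^bsub>?M\<^esub> A = \<one>\<^bsub>?M\<^esub>"
      unfolding A simps(2) mapping_class_group_mult[OF x inv \<phi>] by (rule isotopy_class_eq[OF _ x])
    then show ?thesis using inv by (auto simp: simps)
  qed
qed

section \<open>The fundamental group and the action on it\<close>

lemma loopsD:
  assumes "\<gamma> \<in> loops S x"
  shows "path \<gamma>" "path_image \<gamma> \<subseteq> S" "pathstart \<gamma> = x" "pathfinish \<gamma> = x"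
  using assms by (auto simp: loops_def)

lemma loops_join: "\<gamma> \<in> loops S x \<Longrightarrow> \<eta> \<in> loops S x \<Longrightarrow> \<gamma> +++ \<eta> \<in> loops S x"
  by (simp add: loops_def path_image_join)

lemma loop_class_eqI: "homotopic_paths S \<gamma> \<eta> \<Longrightarrow> loop_class S \<gamma> = loop_class S \<eta>"
  unfolding loop_class_def using homotopic_paths_sym homotopic_paths_trans by blast

lemma loop_class_self: "\<gamma> \<in> loops S x \<Longrightarrow> \<gamma> \<in> loop_class S \<gamma>"
  by (simp add: loop_class_def loops_def)

lemma fundamental_group_carrier: "carrier (fundamental_group S x) = loop_class S ` loops S x"
  by (simp add: fundamental_group_def)

lemma fundamental_group_one: "\<one>\<^bsub>fundamental_group S x\<^esub> = loop_class S (linepath x x)"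
  by (simp add: fundamental_group_def)

lemma fundamental_group_mult:
  assumes \<gamma>: "\<gamma> \<in> loops S x" and \<eta>: "\<eta> \<in> loops S x"
  shows "loop_class S \<gamma> \<otimes>\<^bsub>fundamental_group S x\<^esub> loop_class S \<eta> = loop_class S (\<gamma> +++ \<eta>)"
proof -
  let ?A = "loop_class S \<gamma>" and ?B = "loop_class S \<eta>"
  have "loop_class S (\<gamma>' +++ \<eta>') = loop_class S (\<gamma> +++ \<eta>)" if "\<gamma>' \<in> ?A" "\<eta>' \<in> ?B" for \<gamma>' \<eta>'
    using that loopsD[OF \<gamma>] loopsD[OF \<eta>]
    by (intro loop_class_eqI[OF homotopic_paths_sym] homotopic_paths_join) (auto simp: loop_class_def)
  then have "(\<Union>\<gamma>'\<in>?A. \<Union>\<eta>'\<in>?B. loop_class S (\<gamma>' +++ \<eta>'))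
      = (\<Union>\<gamma>'\<in>?A. \<Union>\<eta>'\<in>?B. loop_class S (\<gamma> +++ \<eta>))"
    by simp
  moreover have "?A \<noteq> {}" "?B \<noteq> {}" using loop_class_self \<gamma> \<eta> by blast+
  ultimately show ?thesis by (simp add: fundamental_group_def)
qed

lemma group_fundamental_group:
  assumes x: "x \<in> S" shows "group (fundamental_group S x)"
proof (rule groupI)
  let ?P = "fundamental_group S x"
  note simps = fundamental_group_carrier fundamental_group_one fundamental_group_mult loops_join
  have lin: "linepath x x \<in> loops S x" using x by (simp add: loops_def)
  show "\<one>\<^bsub>?P\<^esub> \<in> carrier ?P" using lin by (simp add: simps)
  show "A \<otimes>\<^bsub>?P\<^esub> B \<in> carrier ?P" if "A \<in> carrier ?P" "B \<in> carrier ?P" for A B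
    using that by (auto simp: simps)
  show "A \<otimes>\<^bsub>?P\<^esub> B \<otimes>\<^bsub>?P\<^esub> C = A \<otimes>\<^bsub>?P\<^esub> (B \<otimes>\<^bsub>?P\<^esub> C)"
    if "A \<in> carrier ?P" "B \<in> carrier ?P" "C \<in> carrier ?P" for A B C
  proof -
    obtain \<gamma> \<eta> \<zeta> where l: "\<gamma> \<in> loops S x" "\<eta> \<in> loops S x" "\<zeta> \<in> loops S x"
      and "A = loop_class S \<gamma>" "B = loop_class S \<eta>" "C = loop_class S \<zeta>"
      using \<open>A \<in> _\<close> \<open>B \<in> _\<close> \<open>C \<in> _\<close> by (auto simp: simps)
    moreover have "homotopic_paths S (\<gamma> +++ (\<eta> +++ \<zeta>)) ((\<gamma> +++ \<eta>) +++ \<zeta>)"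
      by (rule homotopic_paths_assoc) (use l in \<open>auto simp: loops_def\<close>)
    ultimately show ?thesis by (simp add: simps loop_class_eqI)
  qed
  show "\<one>\<^bsub>?P\<^esub> \<otimes>\<^bsub>?P\<^esub> A = A" if "A \<in> carrier ?P" for A
  proof -
    obtain \<gamma> where l: "\<gamma> \<in> loops S x" "A = loop_class S \<gamma>" using \<open>A \<in> _\<close> by (auto simp: simps)
    then have "homotopic_paths S (linepath x x +++ \<gamma>) \<gamma>"
      by (intro homotopic_paths_lid') (auto simp: loops_def)
    then show ?thesis using l lin by (simp add: simps loop_class_eqI)
  qed
  show "\<exists>B\<in>carrier ?P. B \<otimes>\<^bsub>?P\<^esub> A = \<one>\<^bsub>?P\<^esub>" if "A \<in> carrier ?P" for A
  proof -
    obtain \<gamma> where l: "\<gamma> \<in> loops S x" "A = loop_class S \<gamma>" using \<open>A \<in> _\<close> by (auto simp: simps)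
    then have r: "reversepath \<gamma> \<in> loops S x" by (auto simp: loops_def)
    have "homotopic_paths S (reversepath \<gamma> +++ \<gamma>) (linepath x x)"
      using homotopic_paths_linv[of \<gamma> S] loopsD[OF l(1)] by simp
    then have "loop_class S (reversepath \<gamma>) \<otimes>\<^bsub>?P\<^esub> A = \<one>\<^bsub>?P\<^esub>"
      using l r by (simp add: simps loop_class_eqI)
    then show ?thesis using r by (auto simp: simps)
  qed
qed

lemma diffeos_loops:
  assumes \<phi>: "\<phi> \<in> diffeos S \<nu> x" and \<gamma>: "\<gamma> \<in> loops S x"
  shows "\<phi> \<circ> \<gamma> \<in> loops S x"
proof -
  note D = diffeosD[OF \<phi>] and L = loopsD[OF \<gamma>]
  have "path (\<phi> \<circ> \<gamma>)"
    by (rule path_continuous_image[OF L(1)])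
       (rule continuous_on_subset[OF smooth_map_continuous[OF D(2)] L(2)])
  then show ?thesis
    using D(5,6) L(2,3,4) by (auto simp: loops_def path_image_compose pathstart_compose pathfinish_compose)
qed

text \<open>
  All stages of an isotopy fix \<open>x\<close>, so the images of a loop at \<open>x\<close> form a homotopy relative to
  the endpoints.
\<close>

lemma isotopic_homotopic_paths:
  assumes iso: "isotopic S \<nu> x \<phi> \<psi>" and \<gamma>: "\<gamma> \<in> loops S x"
  shows "homotopic_paths S (\<phi> \<circ> \<gamma>) (\<psi> \<circ> \<gamma>)"
proof -
  obtain H where H: "smooth_map (S \<times> {0..1}) H" "\<forall>t\<in>{0..1::real}. (\<lambda>p. H (p, t)) \<in> diffeos S \<nu> x"
    "\<forall>p\<in>S. H (p, 0) = \<phi> p \<and> H (p, 1) = \<psi> p"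
    using iso unfolding isotopic_def by (elim exE conjE)
  have HS: "H (p, t) \<in> S" if "p \<in> S" "t \<in> {0..1}" for p t
    using diffeosD(6)[of "\<lambda>p. H (p, t)" S \<nu> x] H(2) that by auto
  have Hx: "H (x, t) = x" if "t \<in> {0..1}" for t
    using diffeosD(5)[of "\<lambda>p. H (p, t)" S \<nu> x] H(2) that by auto
  have \<gamma>S: "\<gamma> s \<in> S" if "s \<in> {0..1}" for s using \<gamma> that by (auto simp: loops_def path_image_def)
  have ends: "\<gamma> 0 = x" "\<gamma> 1 = x" using \<gamma> by (auto simp: loops_def pathstart_def pathfinish_def)
  have xS: "x \<in> S" using \<gamma> pathstart_in_path_image[of \<gamma>] by (auto simp: loops_def)
  let ?h = "\<lambda>z :: real \<times> real. H (\<gamma> (snd z), fst z)"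
  have "continuous_on ({0..1} \<times> {0..1}) (\<lambda>z :: real \<times> real. (\<gamma> (snd z), fst z))"
  proof (rule continuous_on_Pair)
    have "continuous_on {0..1} \<gamma>" using \<gamma> by (simp add: loops_def path_def)
    then show "continuous_on ({0..1} \<times> {0..1}) (\<lambda>z :: real \<times> real. \<gamma> (snd z))"
      by (rule continuous_on_compose2) (auto intro: continuous_on_snd continuous_on_id)
    show "continuous_on ({0..1} \<times> {0..1}) (\<lambda>z :: real \<times> real. fst z)"
      by (intro continuous_on_fst continuous_on_id)
  qed
  then have "continuous_on ({0..1} \<times> {0..1}) ?h"
    by (rule continuous_on_compose2[OF smooth_map_continuous[OF H(1)]]) (use \<gamma>S in auto)
  moreover have "?h \<in> ({0..1} \<times> {0..1}) \<rightarrow> S" using HS \<gamma>S by auto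
  ultimately show ?thesis
    unfolding homotopic_paths using H(3) \<gamma>S Hx ends xS
    by (intro exI[of _ ?h]) (auto simp: pathstart_def pathfinish_def)
qed

lemma mcg_act_loop_class:
  assumes \<phi>: "\<phi> \<in> diffeos S \<nu> x" and \<gamma>: "\<gamma> \<in> loops S x"
  shows "mcg_act S (isotopy_class S \<nu> x \<phi>) (loop_class S \<gamma>) = loop_class S (\<phi> \<circ> \<gamma>)"
proof -
  let ?A = "isotopy_class S \<nu> x \<phi>" and ?B = "loop_class S \<gamma>"
  have "loop_class S (\<psi> \<circ> \<eta>) = loop_class S (\<phi> \<circ> \<gamma>)" if "\<psi> \<in> ?A" "\<eta> \<in> ?B" for \<psi> \<eta>
  proof (rule loop_class_eqI[OF homotopic_paths_sym])
    have \<psi>: "\<psi> \<in> diffeos S \<nu> x" "isotopic S \<nu> x \<phi> \<psi>" and \<eta>: "homotopic_paths S \<gamma> \<eta>"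
      using that by (auto simp: isotopy_class_def loop_class_def)
    note \<open>isotopic S \<nu> x \<phi> \<psi>\<close>
    then have "homotopic_paths S (\<phi> \<circ> \<gamma>) (\<psi> \<circ> \<gamma>)" by (rule isotopic_homotopic_paths[OF _ \<gamma>])
    also have "homotopic_paths S (\<psi> \<circ> \<gamma>) (\<psi> \<circ> \<eta>)"
      by (rule homotopic_paths_continuous_image[OF \<eta>])
         (use diffeosD[OF \<psi>(1)] smooth_map_continuous in auto)
    finally show "homotopic_paths S (\<phi> \<circ> \<gamma>) (\<psi> \<circ> \<eta>)" .
  qed
  then have "(\<Union>\<psi>\<in>?A. \<Union>\<eta>\<in>?B. loop_class S (\<psi> \<circ> \<eta>)) = (\<Union>\<psi>\<in>?A. \<Union>\<eta>\<in>?B. loop_class S (\<phi> \<circ> \<gamma>))"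
    by simp
  moreover have "?A \<noteq> {}" "?B \<noteq> {}" using isotopy_class_self[OF \<phi>] loop_class_self[OF \<gamma>] by blast+
  ultimately show ?thesis by (simp add: mcg_act_def)
qed

lemma mcg_act_hom:
  assumes "\<Psi> \<in> carrier (mapping_class_group S \<nu> x)"
  shows "mcg_act S \<Psi> \<in> hom (fundamental_group S x) (fundamental_group S x)"
proof -
  obtain \<phi> where \<phi>: "\<phi> \<in> diffeos S \<nu> x" "\<Psi> = isotopy_class S \<nu> x \<phi>"
    using assms by (auto simp: mapping_class_group_carrier)
  show ?thesis
    by (rule homI)
       (use \<phi> in \<open>auto simp: fundamental_group_carrier fundamental_group_mult mcg_act_loop_class
          diffeos_loops loops_join path_compose_join\<close>)
qed

lemma mcg_act_one:
  assumes "C \<in> carrier (fundamental_group S x)"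
  shows "mcg_act S \<one>\<^bsub>mapping_class_group S \<nu> x\<^esub> C = C"
  using assms by (auto simp: fundamental_group_carrier mapping_class_group_one mcg_act_loop_class diffeos_id)

lemma mcg_act_mult:
  assumes "x \<in> S" "\<Phi> \<in> carrier (mapping_class_group S \<nu> x)" "\<Psi> \<in> carrier (mapping_class_group S \<nu> x)"
    and "C \<in> carrier (fundamental_group S x)"
  shows "mcg_act S (\<Phi> \<otimes>\<^bsub>mapping_class_group S \<nu> x\<^esub> \<Psi>) C = mcg_act S \<Phi> (mcg_act S \<Psi> C)"
  using assms
  by (auto simp: mapping_class_group_carrier fundamental_group_carrier mapping_class_group_mult
      mcg_act_loop_class diffeos_loops diffeos_comp comp_assoc)

section \<open>Homomorphisms out of a presented group\<close>

lemma word_val_closed: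
  assumes "group P" "f ` I \<subseteq> carrier P" "w \<in> lists (I \<times> UNIV)"
  shows "word_val P f w \<in> carrier P"
proof -
  interpret group P by fact
  from assms(3) show ?thesis
    using assms(2) by (induction w) (auto simp: image_subset_iff)
qed

lemma word_val_append:
  assumes "group P" "f ` I \<subseteq> carrier P" "v \<in> lists (I \<times> UNIV)" "w \<in> lists (I \<times> UNIV)"
  shows "word_val P f (v @ w) = word_val P f v \<otimes>\<^bsub>P\<^esub> word_val P f w"
proof -
  interpret group P by fact
  note closed = word_val_closed[OF assms(1,2)]
  from assms(3) show ?thesis
  proof (induction v rule: lists.induct)
    case Nil
    then show ?case using closed[OF assms(4)] by simp
  next
    case (Cons l v)
    then have "f (fst l) \<in> carrier P" using assms(2) by auto
    with Cons closed[OF Cons.hyps(2)] closed[OF assms(4)] show ?case by (simp add: m_assoc)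
  qed
qed

lemma word_val_hom:
  assumes "group P" "group G" "\<phi> \<in> hom P G" "f ` I \<subseteq> carrier P" "w \<in> lists (I \<times> UNIV)"
  shows "\<phi> (word_val P f w) = word_val G (\<lambda>i. \<phi> (f i)) w"
proof -
  interpret group_hom P G \<phi> using assms by (simp add: group_hom_def group_hom_axioms_def)
  from assms(5) show ?thesis
  proof (induction w rule: lists.induct)
    case (Cons l w)
    then have "f (fst l) \<in> carrier P" using assms(4) by auto
    with Cons word_val_closed[OF assms(1,4) Cons.hyps(2)] show ?case by simp
  qed simp
qed

text \<open>
  Every step of \<open>word_equiv\<close> preserves the property of being a word in the generators, so that
  the values of equivalent words can be compared along the whole chain of steps.
\<close>

lemma word_equiv_word_val:
  assumes G: "group G" and h: "h ` I \<subseteq> carrier G" and R: "R \<subseteq> lists (I \<times> UNIV)"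
    and rel: "\<And>r. r \<in> R \<Longrightarrow> word_val G h r = \<one>\<^bsub>G\<^esub>" and "word_equiv I R v w"
  shows "(v \<in> lists (I \<times> UNIV) \<longleftrightarrow> w \<in> lists (I \<times> UNIV)) \<and>
    (v \<in> lists (I \<times> UNIV) \<longrightarrow> word_val G h v = word_val G h w)"
proof -
  interpret group G by fact
  note closed = word_val_closed[OF G h] and app = word_val_append[OF G h]
  show ?thesis
    using assms(5)
  proof induction
    case (word_cancel i v s w)
    then have hi: "h i \<in> carrier G" using h by auto
    have "word_val G h (v @ [(i, s), (i, \<not> s)] @ w) = word_val G h (v @ w)"
      if "v @ w \<in> lists (I \<times> UNIV)"
    proof -
      have v: "v \<in> lists (I \<times> UNIV)" and w: "w \<in> lists (I \<times> UNIV)" using that by simp_all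
      have "[(i, s), (i, \<not> s)] @ w \<in> lists (I \<times> UNIV)" using w word_cancel by simp
      then have "word_val G h (v @ [(i, s), (i, \<not> s)] @ w)
          = word_val G h v \<otimes>\<^bsub>G\<^esub> word_val G h ([(i, s), (i, \<not> s)] @ w)"
        by (rule app[OF v])
      also have "word_val G h ([(i, s), (i, \<not> s)] @ w) = word_val G h w"
        using hi closed[OF w] by (simp add: inv_solve_left' flip: m_assoc)
      finally show ?thesis by (simp add: app[OF v w])
    qed
    then show ?case using word_cancel by auto
  next
    case (word_rel r v w)
    then have r: "r \<in> lists (I \<times> UNIV)" using R by blast
    have "word_val G h (v @ r @ w) = word_val G h (v @ w)" if "v @ w \<in> lists (I \<times> UNIV)"
    proof -
      have v: "v \<in> lists (I \<times> UNIV)" and w: "w \<in> lists (I \<times> UNIV)" using that by simp_all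
      have "r @ w \<in> lists (I \<times> UNIV)" using r w by simp
      then show ?thesis
        using app[OF v, of "r @ w"] app[OF r w] app[OF v w] rel[OF word_rel] closed[OF w] by simp
    qed
    then show ?case using r by auto
  qed auto
qed

text \<open>
  The universal property of the presentation: sending the value of a word in \<open>P\<close> to its value
  in \<open>G\<close> does not depend on the word, since words with the same value in \<open>P\<close> are equivalent.
\<close>

lemma presented_by_hom_exists:
  assumes pres: "presented_by P I f R" and P: "group P" and G: "group G"
    and h: "h ` I \<subseteq> carrier G" and R: "R \<subseteq> lists (I \<times> UNIV)"
    and rel: "\<And>r. r \<in> R \<Longrightarrow> word_val G h r = \<one>\<^bsub>G\<^esub>"
  obtains \<phi> where "\<phi> \<in> hom P G" "\<phi> \<in> extensional (carrier P)" "\<And>i. i \<in> I \<Longrightarrow> \<phi> (f i) = h i"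
proof -
  interpret P: group P by fact
  interpret G: group G by fact
  let ?W = "lists (I \<times> (UNIV :: bool set))"
  have f: "f ` I \<subseteq> carrier P" and car: "carrier P = word_val P f ` ?W"
    and eq: "\<And>v w. v \<in> ?W \<Longrightarrow> w \<in> ?W \<Longrightarrow> word_val P f v = word_val P f w \<longleftrightarrow> word_equiv I R v w"
    using pres by (auto simp: presented_by_def)
  define \<phi> where "\<phi> = (\<lambda>C\<in>carrier P. word_val G h (SOME w. w \<in> ?W \<and> word_val P f w = C))"
  have \<phi>: "\<phi> (word_val P f w) = word_val G h w" if w: "w \<in> ?W" for w
  proof -
    let ?v = "SOME v. v \<in> ?W \<and> word_val P f v = word_val P f w"
    have v: "?v \<in> ?W \<and> word_val P f ?v = word_val P f w" by (rule someI[of _ w]) (use w in simp)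
    then have "word_equiv I R ?v w" using eq w by blast
    from word_equiv_word_val[OF G h R rel this] v have "word_val G h ?v = word_val G h w" by blast
    then show ?thesis using w car by (simp add: \<phi>_def)
  qed
  have "\<phi> \<in> hom P G"
  proof (rule homI)
    show "\<phi> C \<in> carrier G" if "C \<in> carrier P" for C
      using that \<phi> word_val_closed[OF G h] unfolding car by fastforce
    show "\<phi> (C \<otimes>\<^bsub>P\<^esub> D) = \<phi> C \<otimes>\<^bsub>G\<^esub> \<phi> D" if CD: "C \<in> carrier P" "D \<in> carrier P" for C D
    proof -
      obtain v w where vw: "v \<in> ?W" "w \<in> ?W" "C = word_val P f v" "D = word_val P f w"
        using CD unfolding car by blast
      then have "C \<otimes>\<^bsub>P\<^esub> D = word_val P f (v @ w)" using word_val_append[OF P f] by simp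
      with vw show ?thesis
        using \<phi>[of "v @ w"] word_val_append[OF G h] by (simp add: \<phi>)
    qed
  qed
  moreover have "\<phi> (f i) = h i" if "i \<in> I" for i
  proof -
    have "f i \<in> carrier P" "h i \<in> carrier G" using that f h by auto
    then show ?thesis using \<phi>[of "[(i, True)]"] that by simp
  qed
  ultimately show thesis using that by (simp add: \<phi>_def)
qed

lemma presented_by_hom_unique:
  assumes pres: "presented_by P I f R" and P: "group P" and G: "group G"
    and \<phi>: "\<phi> \<in> hom P G" "\<phi> \<in> extensional (carrier P)"
    and \<psi>: "\<psi> \<in> hom P G" "\<psi> \<in> extensional (carrier P)"
    and eq: "\<And>i. i \<in> I \<Longrightarrow> \<phi> (f i) = \<psi> (f i)"
  shows "\<phi> = \<psi>"
proof (rule extensionalityI[OF \<phi>(2) \<psi>(2)])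
  have f: "f ` I \<subseteq> carrier P" and car: "carrier P = word_val P f ` lists (I \<times> UNIV)"
    using pres by (auto simp: presented_by_def)
  have vals: "word_val G (\<lambda>i. \<phi> (f i)) w = word_val G (\<lambda>i. \<psi> (f i)) w" if "w \<in> lists (I \<times> UNIV)" for w
    using that by (induction w) (auto simp: eq)
  fix C assume "C \<in> carrier P"
  then obtain w where w: "w \<in> lists (I \<times> UNIV)" "C = word_val P f w" unfolding car by blast
  then show "\<phi> C = \<psi> C"
    using vals word_val_hom[OF P G \<phi>(1) f] word_val_hom[OF P G \<psi>(1) f] by simp
qed

section \<open>Linear maps between free vector spaces\<close>

lemma fscale_fscale: "fscale c (fscale d v) = fscale (c * d) v"
  by (auto intro!: poly_mapping_eqI simp: algebra_simps)

lemma fscale_sum: "fscale c (\<Sum>i\<in>I. v i) = (\<Sum>i\<in>I. fscale c (v i))"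
  by (auto intro!: poly_mapping_eqI simp: lookup_sum sum_distrib_left)

lemma fscale_zero [simp]: "fscale c 0 = 0"
  by (auto intro!: poly_mapping_eqI)

lemma keys_fscale: "Poly_Mapping.keys (fscale c v) \<subseteq> Poly_Mapping.keys v"
  by (auto simp: in_keys_iff)

lemma free_space_zero: "0 \<in> free_space B"
  by (simp add: free_space_def)

lemma free_space_bas: "b \<in> B \<Longrightarrow> bas b \<in> free_space B"
  by (simp add: free_space_def bas_def)

lemma free_space_add: "v \<in> free_space B \<Longrightarrow> w \<in> free_space B \<Longrightarrow> v + w \<in> free_space B"
  using keys_add[of v w] by (auto simp: free_space_def)

lemma free_space_fscale: "v \<in> free_space B \<Longrightarrow> fscale c v \<in> free_space B"
  using keys_fscale by (fastforce simp: free_space_def)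

lemma free_space_sum: "(\<And>i. i \<in> I \<Longrightarrow> v i \<in> free_space B) \<Longrightarrow> (\<Sum>i\<in>I. v i) \<in> free_space B"
  by (induction I rule: infinite_finite_induct) (auto simp: free_space_zero free_space_add)

lemma subspace_free_space: "Modules.module.subspace fscale (free_space B)"
proof -
  interpret vector_space fscale by (rule vector_space_fscale)
  show ?thesis
    by (simp add: subspace_def free_space_zero free_space_add free_space_fscale)
qed

lemma lin_ext_fscale: "lin_ext \<phi> (fscale c v) = fscale c (lin_ext \<phi> v)"
  by (subst (1 2) lin_ext_eq_sum[where A = "Poly_Mapping.keys v"])
     (auto simp: keys_fscale fscale_sum fscale_fscale)

lemma lin_ext_in_free_space:
  "v \<in> free_space B \<Longrightarrow> (\<And>b. b \<in> B \<Longrightarrow> \<phi> b \<in> free_space C) \<Longrightarrow> lin_ext \<phi> v \<in> free_space C"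
  unfolding lin_ext_def by (intro free_space_sum free_space_fscale) (auto simp: free_space_def)

lemma lin_ext_cong:
  "v \<in> free_space B \<Longrightarrow> (\<And>b. b \<in> B \<Longrightarrow> \<phi> b = \<psi> b) \<Longrightarrow> lin_ext \<phi> v = lin_ext \<psi> v"
  unfolding lin_ext_def by (intro sum.cong) (auto simp: free_space_def)

lemma lin_ext_lin_ext: "lin_ext \<phi> (lin_ext \<psi> v) = lin_ext (\<lambda>b. lin_ext \<phi> (\<psi> b)) v"
  by (subst (2 3) lin_ext_def) (simp add: lin_ext_sum lin_ext_fscale)

lemma lin_ext_bas_eq_id: "lin_ext bas v = v"
proof (rule poly_mapping_eqI)
  fix b
  have "Poly_Mapping.lookup (lin_ext bas v) b
      = (\<Sum>c\<in>Poly_Mapping.keys v. Poly_Mapping.lookup v c * (if c = b then 1 else 0))"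
    by (simp add: lin_ext_def lookup_sum bas_def lookup_single when_def)
  then show "Poly_Mapping.lookup (lin_ext bas v) b = Poly_Mapping.lookup v b"
    by (simp add: in_keys_iff if_distrib[where f = "(*) _"] cong: if_cong)
qed

lemma linear_betw_lin_ext:
  "(\<And>b. b \<in> B \<Longrightarrow> \<phi> b \<in> free_space C) \<Longrightarrow> linear_betw (free_space B) (free_space C) (lin_ext \<phi>)"
  by (auto simp: linear_betw_def lin_ext_add lin_ext_fscale intro: lin_ext_in_free_space)

lemma lin_ext_bas_left_inverse:
  assumes "v \<in> free_space B" "\<And>b. b \<in> B \<Longrightarrow> j (i b) = b"
  shows "lin_ext (\<lambda>c. bas (j c)) (lin_ext (\<lambda>b. bas (i b)) v) = v"
proof -
  have "lin_ext (\<lambda>c. bas (j c)) (lin_ext (\<lambda>b. bas (i b)) v) = lin_ext (\<lambda>b. bas (j (i b))) v"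
    by (simp add: lin_ext_lin_ext)
  also have "\<dots> = lin_ext bas v" by (rule lin_ext_cong[OF assms(1)]) (simp add: assms(2))
  finally show ?thesis by (simp add: lin_ext_bas_eq_id)
qed

lemma bij_betw_lin_ext_bas:
  assumes "bij_betw i B C"
  shows "bij_betw (lin_ext (\<lambda>b. bas (i b))) (free_space B) (free_space C)"
proof -
  have inv: "bij_betw (inv_into B i) C B" by (rule bij_betw_inv_into) fact
  note maps = bij_betwE[OF assms] bij_betwE[OF inv]
  show ?thesis
    by (rule bij_betw_byWitness[where f' = "lin_ext (\<lambda>c. bas (inv_into B i c))"])
       (use maps assms in \<open>auto simp: lin_ext_bas_left_inverse bij_betw_inv_into_left
          bij_betw_inv_into_right intro!: lin_ext_in_free_space free_space_bas\<close>)
qed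

lemma group_module_transfer:
  assumes V: "group_module H V \<rho>" and f: "linear_betw V W f" and f': "linear_betw W V f'"
    and ff': "\<And>w. w \<in> W \<Longrightarrow> f (f' w) = w" and f'f: "\<And>v. v \<in> V \<Longrightarrow> f' (f v) = v"
    and W: "Modules.module.subspace fscale W"
  shows "group_module H W (\<lambda>h w. f (\<rho> h (f' w)))"
proof -
  have f'V: "\<And>w. w \<in> W \<Longrightarrow> f' w \<in> V" and fW: "\<And>v. v \<in> V \<Longrightarrow> f v \<in> W"
    using f f' by (auto simp: linear_betw_def)
  have \<rho>V: "\<rho> h v \<in> V" if "h \<in> carrier H" "v \<in> V" for h v
    using V that by (force simp: group_module_def linear_betw_def)
  interpret H: group H using V by (simp add: group_module_def)
  show ?thesis
    using V f f' W
    by (auto simp: group_module_def linear_betw_def f'V fW \<rho>V ff' f'f)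
qed

section \<open>The grading of the tensor powers\<close>

text \<open>
  A word of grade \<open>h\<close> is fixed by \<open>\<delta>_h \<otimes> e\<close> and annihilated by the other \<open>\<delta>_k \<otimes> e\<close>. The
  commutator of the first tensor factor comes last in the product, because the first tensor
  factors in \<open>\<Delta>(\<delta>_h \<otimes> e) = \<Sum>\<^sub>c (\<delta>_c \<otimes> e) \<otimes> (\<delta>_{h c\<^sup>-\<^sup>1} \<otimes> e)\<close> are multiplied to the second ones from
  the right to give \<open>h\<close>.
\<close>

primrec grade :: "('g, 'm) monoid_scheme \<Rightarrow> ('g \<times> 'g) list \<Rightarrow> 'g" where
  "grade G [] = \<one>\<^bsub>G\<^esub>"
| "grade G (y # w) = grade G w \<otimes>\<^bsub>G\<^esub> commutator G (inv\<^bsub>G\<^esub> (snd y)) (fst y)"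

definition neutral_words :: "('g, 'm) monoid_scheme \<Rightarrow> nat \<Rightarrow> ('g \<times> 'g) list set" where
  "neutral_words G n =
    {w. length w = n \<and> set w \<subseteq> carrier G \<times> carrier G \<and> grade G w = \<one>\<^bsub>G\<^esub>}"

lemma commutator_closed:
  "group G \<Longrightarrow> a \<in> carrier G \<Longrightarrow> b \<in> carrier G \<Longrightarrow> commutator G a b \<in> carrier G"
  by (simp add: commutator_def group.is_monoid monoid.m_closed)

lemma grade_closed:
  "group G \<Longrightarrow> set w \<subseteq> carrier G \<times> carrier G \<Longrightarrow> grade G w \<in> carrier G"
  by (induction w) (auto simp: group.is_monoid monoid.m_closed commutator_closed)

lemma tens_bas: "tens (bas v) (bas w) = bas (v @ w)"
  by (simp add: tens_def)

lemma tens_zero: "tens 0 v = 0" "tens v 0 = 0"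
  by (simp_all add: tens_def) (simp add: lin_ext_def)

lemma tens_list_bas: "tens_list (map (\<lambda>i. u (a i) (b i)) xs) = bas (map (\<lambda>i. (a i, b i)) xs)"
  by (induction xs) (simp_all add: tens_list_def u_def tens_bas)

lemma tens_op_bas:
  assumes "length xs = p" "length ys = k" "F (bas ys) = bas ys'"
  shows "tens_op p k F (bas (xs @ ys @ zs)) = bas (xs @ ys' @ zs)"
  using assms by (simp add: tens_op_def tens_bas)

text \<open>
  Of the summands of the coproduct only the one survives whose \<open>c\<close> is the commutator of the first
  tensor factor; it asks the remaining word to have the complementary grade.
\<close>

lemma dbl_act_word_delta:
  assumes "group G" "finite (carrier G)"
  shows "h \<in> carrier G \<Longrightarrow> set w \<subseteq> carrier G \<times> carrier G \<Longrightarrow>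
    dbl_act_word G w (bas (h, \<one>\<^bsub>G\<^esub>)) = (if h = grade G w then bas w else (0 :: ('g, 'k::field) tensors))"
proof (induction w arbitrary: h)
  case Nil
  then show ?case
    by (auto simp: dbl_counit_def bas_def intro!: poly_mapping_eqI)
next
  case (Cons y w)
  interpret group G by fact
  obtain a b where y: "y = (a, b)" by (cases y)
  have ab: "a \<in> carrier G" "b \<in> carrier G" and w: "set w \<subseteq> carrier G \<times> carrier G"
    using Cons.prems y by auto
  let ?k = "commutator G (inv\<^bsub>G\<^esub> b) a"
  have k: "?k \<in> carrier G" using ab by (simp add: commutator_closed[OF assms(1)])
  have eq: "h \<otimes>\<^bsub>G\<^esub> inv\<^bsub>G\<^esub> ?k = grade G w \<longleftrightarrow> h = grade G w \<otimes>\<^bsub>G\<^esub> ?k"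
    using Cons.prems(1) k grade_closed[OF assms(1) w] inv_solve_right' by metis
  have "dbl_act_word G (y # w) (bas (h, \<one>\<^bsub>G\<^esub>)) =
      (\<Sum>c\<in>carrier G. tens (coadj G (bas (c, \<one>\<^bsub>G\<^esub>)) y)
        (dbl_act_word G w (bas (h \<otimes>\<^bsub>G\<^esub> inv\<^bsub>G\<^esub> c, \<one>\<^bsub>G\<^esub>))) :: ('g, 'k) tensors)"
    by (simp add: dbl_comult_def lin_ext_sum)
  also have "\<dots> = (\<Sum>c\<in>carrier G. if c = ?k
      then if h = grade G w \<otimes>\<^bsub>G\<^esub> ?k then bas (y # w) else 0 else 0)"
    using Cons.prems(1) Cons.IH[OF _ w] ab eq
    by (intro sum.cong refl)
       (auto simp: y coadj_delta[OF assms(1)] tens_zero tens_bas u_def)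
  also have "\<dots> = (if h = grade G w \<otimes>\<^bsub>G\<^esub> ?k then bas (y # w) else 0)"
    using k assms(2) by simp
  finally show ?case by (simp add: y)
qed

text \<open>
  Projecting onto the words of grade \<open>e\<close> fixes exactly the combinations of such words, because
  the image of the projection consists of such combinations.
\<close>

lemma Ltens_e_eq_free_space:
  assumes G: "group G" "finite (carrier G)"
  shows "Ltens_e G n = free_space (neutral_words G n)"
proof -
  let ?W = "{w. length w = n \<and> set w \<subseteq> carrier G \<times> carrier G}"
  let ?p = "\<lambda>w. if grade G w = \<one>\<^bsub>G\<^esub> then bas w else 0"
  interpret group G by fact
  have act: "dbl_act G (bas (\<one>\<^bsub>G\<^esub>, \<one>\<^bsub>G\<^esub>)) v = lin_ext ?p v" if "v \<in> free_space ?W" for v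
    unfolding dbl_act_def
    by (rule lin_ext_cong[OF that]) (auto simp: dbl_act_word_delta[OF G])
  have "v \<in> Ltens_e G n \<longleftrightarrow> v \<in> free_space (neutral_words G n)" for v
  proof
    assume "v \<in> Ltens_e G n"
    then have v: "v \<in> free_space ?W" "dbl_act G (bas (\<one>\<^bsub>G\<^esub>, \<one>\<^bsub>G\<^esub>)) v = v"
      by (auto simp: Ltens_e_def Ltens_def)
    have "lin_ext ?p v \<in> free_space (neutral_words G n)"
      by (rule lin_ext_in_free_space[OF v(1)])
         (auto simp: neutral_words_def free_space_zero intro: free_space_bas)
    then show "v \<in> free_space (neutral_words G n)" using act[OF v(1)] v(2) by metis
  next
    assume v: "v \<in> free_space (neutral_words G n)"
    then have vW: "v \<in> free_space ?W" by (auto simp: free_space_def neutral_words_def)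
    have "lin_ext ?p v = lin_ext bas v" by (rule lin_ext_cong[OF v]) (simp add: neutral_words_def)
    then show "v \<in> Ltens_e G n"
      using vW act[OF vW] by (simp add: Ltens_e_def Ltens_def lin_ext_bas_eq_id)
  qed
  then show ?thesis by blast
qed

text \<open>
  Inverting the second entries turns \<open>[b\<^sup>-\<^sup>1, a]\<close> into \<open>[b, a] = [a, b]\<^sup>-\<^sup>1\<close>; with the reversed
  order of the factors, the grade is the inverse of the value of the surface relator.
\<close>

lemma grade_handles:
  assumes G: "group G" and ab: "\<And>i. i \<in> set xs \<Longrightarrow> h (Alpha i) \<in> carrier G \<and> h (Beta i) \<in> carrier G"
  shows "grade G (map (\<lambda>i. (h (Alpha i), inv\<^bsub>G\<^esub> (h (Beta i)))) xs) =
    inv\<^bsub>G\<^esub> (word_val G h (concat (map (\<lambda>i.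
      [(Alpha i, True), (Beta i, True), (Alpha i, False), (Beta i, False)]) xs)))"
  using ab
proof (induction xs)
  case Nil
  interpret group G by fact
  show ?case by simp
next
  case (Cons i xs)
  interpret group G by fact
  let ?w = "concat (map (\<lambda>i.
      [(Alpha i, True), (Beta i, True), (Alpha i, False), (Beta i, False)]) xs)"
  have c: "h (Alpha i) \<in> carrier G" "h (Beta i) \<in> carrier G" using Cons.prems by auto
  have "word_val G h ?w \<in> carrier G"
    by (rule word_val_closed[OF G, of _ "Alpha ` set xs \<union> Beta ` set xs"])
       (use Cons.prems in auto)
  then show ?case
    using c Cons by (simp add: commutator_def inv_mult_group m_assoc)
qed

section \<open>The representation variety in coordinates\<close>

lemma surface_relator_in_lists: "surface_relator g \<in> lists (handle_gens g \<times> UNIV)"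
  by (auto simp: surface_relator_def handle_gens_def)

locale surface_reps =
  fixes G :: "('g, 'm) monoid_scheme"
    and g :: nat
    and S :: "pt set" and \<nu> :: "pt \<Rightarrow> pt" and x :: pt
    and \<alpha> \<beta> :: "nat \<Rightarrow> real \<Rightarrow> pt"
  assumes group_G: "group G"
    and marked: "marked_surface g S \<nu> x \<alpha> \<beta>"
begin

abbreviation "P \<equiv> fundamental_group S x"
abbreviation "\<Gamma> \<equiv> mapping_class_group S \<nu> x"
abbreviation "a i \<equiv> loop_class S (\<alpha> i)"
abbreviation "b i \<equiv> loop_class S (\<beta> i)"
abbreviation "gen \<equiv> case_handle_gen a b"

lemma x_in_S: "x \<in> S"
  using marked by (simp add: marked_surface_def)

lemma group_P: "group P" and group_\<Gamma>: "group \<Gamma>"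
  using x_in_S by (simp_all add: group_fundamental_group group_mapping_class_group)

sublocale G: group G by (rule group_G)
sublocale P: group P by (rule group_P)
sublocale MCG: group \<Gamma> by (rule group_\<Gamma>)

lemma presentation: "presented_by P (handle_gens g) gen {surface_relator g}"
  using marked by (simp add: marked_surface_def)

lemma gen_closed: "gen ` handle_gens g \<subseteq> carrier P"
  using presentation unfolding presented_by_def by (elim conjE)

lemma handle_loops_closed: "i \<in> {1..g} \<Longrightarrow> a i \<in> carrier P" "i \<in> {1..g} \<Longrightarrow> b i \<in> carrier P"
proof -
  have sub: "gen j \<in> carrier P" if "j \<in> handle_gens g" for j
    using gen_closed that by blast
  show "i \<in> {1..g} \<Longrightarrow> a i \<in> carrier P" "i \<in> {1..g} \<Longrightarrow> b i \<in> carrier P"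
    using sub[of "Alpha i"] sub[of "Beta i"] by (auto simp: handle_gens_def)
qed

lemma surface_relator_trivial: "word_val P gen (surface_relator g) = \<one>\<^bsub>P\<^esub>"
proof -
  have "word_equiv (handle_gens g) {surface_relator g} (surface_relator g) []"
    using word_rel[of "surface_relator g" "{surface_relator g}" "handle_gens g" "[]" "[]"] by simp
  moreover have "\<forall>v\<in>lists (handle_gens g \<times> UNIV). \<forall>w\<in>lists (handle_gens g \<times> UNIV).
      word_val P gen v = word_val P gen w \<longleftrightarrow> word_equiv (handle_gens g) {surface_relator g} v w"
    using presentation unfolding presented_by_def by (elim conjE)
  ultimately have "word_val P gen (surface_relator g) = word_val P gen []"
    using surface_relator_in_lists[of g] lists.Nil[of "handle_gens g \<times> UNIV"] by metis
  then show ?thesis by simp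
qed

lemma rep_variety_hom: "f \<in> rep_variety S x G \<Longrightarrow> f \<in> hom P G"
  by (simp add: rep_variety_def)

lemma rep_variety_group_hom: "f \<in> rep_variety S x G \<Longrightarrow> group_hom P G f"
  using group_G group_P by (simp add: rep_variety_def group_hom_def group_hom_axioms_def)

definition handle_word :: "((real \<Rightarrow> pt) set \<Rightarrow> 'g) \<Rightarrow> ('g \<times> 'g) list" where
  "handle_word f = map (\<lambda>i. (f (a i), inv\<^bsub>G\<^esub> (f (b i)))) [1..<Suc g]"

lemma Theta_eq_lin_ext: "Theta g S \<alpha> \<beta> G = lin_ext (\<lambda>f. bas (handle_word f))"
  by (simp add: Theta_def tens_list_bas handle_word_def del: upt_Suc)

lemma grade_handle_word:
  assumes "\<And>i. i \<in> {1..g} \<Longrightarrow> h (Alpha i) \<in> carrier G \<and> h (Beta i) \<in> carrier G"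
  shows "grade G (map (\<lambda>i. (h (Alpha i), inv\<^bsub>G\<^esub> (h (Beta i)))) [1..<Suc g])
    = inv\<^bsub>G\<^esub> (word_val G h (surface_relator g))"
  unfolding surface_relator_def by (rule grade_handles[OF group_G]) (use assms in auto)

text \<open>
  A representation is determined by its values on the generators, and values on the generators
  extend to a representation iff they satisfy the surface relation, that is, iff the word that
  they form has trivial grade.
\<close>

lemma bij_betw_handle_word: "bij_betw handle_word (rep_variety S x G) (neutral_words G g)"
  unfolding bij_betw_def
proof
  show "inj_on handle_word (rep_variety S x G)"
  proof
    fix f f' assume f: "f \<in> rep_variety S x G" and f': "f' \<in> rep_variety S x G"
      and eq: "handle_word f = handle_word f'"
    have pair: "(f (a i), inv\<^bsub>G\<^esub> (f (b i))) = (f' (a i), inv\<^bsub>G\<^esub> (f' (b i)))" if "i \<in> {1..g}" for i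
    proof -
      have "i \<in> set [1..<Suc g]" using that by auto
      then show ?thesis using eq unfolding handle_word_def map_eq_conv by blast
    qed
    have "f (gen j) = f' (gen j)" if j: "j \<in> handle_gens g" for j
    proof (cases j)
      case (Alpha i)
      then show ?thesis using pair[of i] j by (auto simp: handle_gens_def)
    next
      case (Beta i)
      then have i: "i \<in> {1..g}" using j by (auto simp: handle_gens_def)
      then have c: "f (b i) \<in> carrier G" "f' (b i) \<in> carrier G"
        using rep_variety_group_hom[OF f] rep_variety_group_hom[OF f'] handle_loops_closed(2)
        by (simp_all add: group_hom.hom_closed)
      have "inv\<^bsub>G\<^esub> (inv\<^bsub>G\<^esub> (f (b i))) = inv\<^bsub>G\<^esub> (inv\<^bsub>G\<^esub> (f' (b i)))" using pair[OF i] by simp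
      then show ?thesis using c Beta by simp
    qed
    then show "f = f'"
      using f f' by (intro presented_by_hom_unique[OF presentation group_P group_G])
        (auto simp: rep_variety_def)
  qed
  show "handle_word ` rep_variety S x G = neutral_words G g"
  proof (intro equalityI subsetI)
    fix w assume "w \<in> handle_word ` rep_variety S x G"
    then obtain f where f: "f \<in> rep_variety S x G" "w = handle_word f" by blast
    interpret f: group_hom P G f by (rule rep_variety_group_hom) (rule f)
    have c: "f (a i) \<in> carrier G" "f (b i) \<in> carrier G" if "i \<in> {1..g}" for i
      using handle_loops_closed that by simp_all
    have "f (word_val P gen (surface_relator g)) = word_val G (\<lambda>j. f (gen j)) (surface_relator g)"
      by (rule word_val_hom[OF group_P group_G f.homh gen_closed surface_relator_in_lists])
    then have "word_val G (\<lambda>j. f (gen j)) (surface_relator g) = \<one>\<^bsub>G\<^esub>"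
      by (simp add: surface_relator_trivial)
    then have "grade G w = \<one>\<^bsub>G\<^esub>"
      using grade_handle_word[of "\<lambda>j. f (gen j)"] c f(2) by (simp add: handle_word_def del: upt_Suc)
    moreover have "set w \<subseteq> carrier G \<times> carrier G" using c f(2) by (auto simp: handle_word_def)
    ultimately show "w \<in> neutral_words G g"
      using f(2) by (simp add: neutral_words_def handle_word_def del: upt_Suc)
  next
    fix w assume w: "w \<in> neutral_words G g"
    have c: "fst (w ! (i - 1)) \<in> carrier G" "snd (w ! (i - 1)) \<in> carrier G" if "i \<in> {1..g}" for i
    proof -
      have "w ! (i - 1) \<in> set w" using w that by (auto simp: neutral_words_def)
      then show "fst (w ! (i - 1)) \<in> carrier G" "snd (w ! (i - 1)) \<in> carrier G"
        using w by (auto simp: neutral_words_def)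
    qed
    define h where "h = case_handle_gen (\<lambda>i. fst (w ! (i - 1))) (\<lambda>i. inv\<^bsub>G\<^esub> (snd (w ! (i - 1))))"
    have h: "h ` handle_gens g \<subseteq> carrier G" using c by (auto simp: handle_gens_def h_def)
    have w_eq: "w = map (\<lambda>i. (h (Alpha i), inv\<^bsub>G\<^esub> (h (Beta i)))) [1..<Suc g]"
    proof (rule nth_equalityI)
      show "length w = length (map (\<lambda>i. (h (Alpha i), inv\<^bsub>G\<^esub> (h (Beta i)))) [1..<Suc g])"
        using w by (simp add: neutral_words_def del: upt_Suc)
      fix i assume i: "i < length w"
      then have "i < g" using w by (simp add: neutral_words_def)
      moreover from this have "snd (w ! i) \<in> carrier G" using c(2)[of "Suc i"] by simp
      ultimately show "w ! i = map (\<lambda>i. (h (Alpha i), inv\<^bsub>G\<^esub> (h (Beta i)))) [1..<Suc g] ! i"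
        by (simp add: h_def del: upt_Suc)
    qed
    have "grade G w = inv\<^bsub>G\<^esub> (word_val G h (surface_relator g))"
      by (subst w_eq, rule grade_handle_word) (use c in \<open>auto simp: h_def\<close>)
    then have "word_val G h (surface_relator g) = \<one>\<^bsub>G\<^esub>"
      using w word_val_closed[OF group_G h surface_relator_in_lists]
      by (simp add: neutral_words_def G.inv_eq_1_iff)
    then obtain f where f: "f \<in> hom P G" "f \<in> extensional (carrier P)"
      "\<And>j. j \<in> handle_gens g \<Longrightarrow> f (gen j) = h j"
      using presented_by_hom_exists[OF presentation group_P group_G h] surface_relator_in_lists
      by auto
    have "f (a i) = h (Alpha i)" "f (b i) = h (Beta i)" if "i \<in> {1..g}" for i
      using f(3)[of "Alpha i"] f(3)[of "Beta i"] that by (auto simp: handle_gens_def)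
    then have "handle_word f = w" by (subst w_eq) (auto simp: handle_word_def)
    then show "w \<in> handle_word ` rep_variety S x G" using f by (auto simp: rep_variety_def)
  qed
qed

section \<open>The action on representations\<close>

definition rep_twist :: "(pt \<Rightarrow> pt) set \<Rightarrow> ((real \<Rightarrow> pt) set \<Rightarrow> 'g) \<Rightarrow> (real \<Rightarrow> pt) set \<Rightarrow> 'g" where
  "rep_twist \<Psi> f = (\<lambda>C\<in>carrier P. f (mcg_act S (inv\<^bsub>\<Gamma>\<^esub> \<Psi>) C))"

lemma rep_act_eq_lin_ext: "rep_act S \<nu> x \<Psi> = lin_ext (\<lambda>f. bas (rep_twist \<Psi> f))"
  by (simp add: rep_act_def rep_twist_def)

lemma mcg_act_closed: "\<Psi> \<in> carrier \<Gamma> \<Longrightarrow> C \<in> carrier P \<Longrightarrow> mcg_act S \<Psi> C \<in> carrier P"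
  using mcg_act_hom[of \<Psi> S \<nu> x] by (auto simp: hom_def)

lemma rep_twist_in_rep_variety:
  assumes \<Psi>: "\<Psi> \<in> carrier \<Gamma>" and f: "f \<in> rep_variety S x G"
  shows "rep_twist \<Psi> f \<in> rep_variety S x G"
proof -
  have "f \<circ> mcg_act S (inv\<^bsub>\<Gamma>\<^esub> \<Psi>) \<in> hom P G"
    by (rule hom_compose[OF mcg_act_hom]) (use \<Psi> f rep_variety_hom in auto)
  then show ?thesis
    unfolding rep_variety_def rep_twist_def by (auto simp: hom_def)
qed

lemma rep_twist_one: "f \<in> rep_variety S x G \<Longrightarrow> rep_twist \<one>\<^bsub>\<Gamma>\<^esub> f = f"
  by (rule extensionalityI[of _ "carrier P"]) (auto simp: rep_twist_def rep_variety_def mcg_act_one)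

lemma rep_twist_mult:
  assumes "\<Phi> \<in> carrier \<Gamma>" "\<Psi> \<in> carrier \<Gamma>"
  shows "rep_twist (\<Phi> \<otimes>\<^bsub>\<Gamma>\<^esub> \<Psi>) f = rep_twist \<Phi> (rep_twist \<Psi> f)"
  using assms
  by (auto simp: rep_twist_def MCG.inv_mult_group mcg_act_mult[OF x_in_S] mcg_act_closed
      intro!: restrict_ext)

text \<open>
  The action on representations is defined by inverses of mapping classes, whereas the generators
  are described by how they themselves move loops. This is the formula \<open>f = f' \<circ> \<psi>\<^sub>*\<close>, into which
  those descriptions can be inserted as they stand.
\<close>

lemma rep_twist_mcg_act:
  assumes "\<Psi> \<in> carrier \<Gamma>" "C \<in> carrier P"
  shows "rep_twist \<Psi> f (mcg_act S \<Psi> C) = f C"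
  using assms mcg_act_mult[OF x_in_S, of "inv\<^bsub>\<Gamma>\<^esub> \<Psi>" \<nu> \<Psi> C]
  by (simp add: rep_twist_def mcg_act_closed mcg_act_one)

lemma group_module_rep_space:
  "group_module \<Gamma> (rep_space S x G :: (((real \<Rightarrow> pt) set \<Rightarrow> 'g) \<Rightarrow>\<^sub>0 'k::field) set) (rep_act S \<nu> x)"
  unfolding group_module_def rep_space_def
proof (intro conjI ballI)
  let ?V = "free_space (rep_variety S x G) :: (((real \<Rightarrow> pt) set \<Rightarrow> 'g) \<Rightarrow>\<^sub>0 'k) set"
  show "group \<Gamma>" by (rule group_\<Gamma>)
  show "Modules.module.subspace fscale ?V" by (rule subspace_free_space)
  show "linear_betw ?V ?V (rep_act S \<nu> x \<Psi>)" if "\<Psi> \<in> carrier \<Gamma>" for \<Psi>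
    unfolding rep_act_eq_lin_ext
    by (rule linear_betw_lin_ext) (simp add: rep_twist_in_rep_variety that free_space_bas)
  show "rep_act S \<nu> x \<one>\<^bsub>\<Gamma>\<^esub> v = v" if "v \<in> ?V" for v
  proof -
    have "lin_ext (\<lambda>f. bas (rep_twist \<one>\<^bsub>\<Gamma>\<^esub> f)) v = lin_ext bas v"
      by (rule lin_ext_cong[OF that]) (simp add: rep_twist_one)
    then show ?thesis by (simp add: rep_act_eq_lin_ext lin_ext_bas_eq_id)
  qed
  show "rep_act S \<nu> x (\<Phi> \<otimes>\<^bsub>\<Gamma>\<^esub> \<Psi>) v = rep_act S \<nu> x \<Phi> (rep_act S \<nu> x \<Psi> v)"
    if "\<Phi> \<in> carrier \<Gamma>" "\<Psi> \<in> carrier \<Gamma>" for \<Phi> \<Psi> and v :: "((real \<Rightarrow> pt) set \<Rightarrow> 'g) \<Rightarrow>\<^sub>0 'k"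
    using that by (simp add: rep_act_eq_lin_ext lin_ext_lin_ext rep_twist_mult)
qed

section \<open>The operators of the generators\<close>

lemma tens_op_Theta:
  fixes v :: "((real \<Rightarrow> pt) set \<Rightarrow> 'g) \<Rightarrow>\<^sub>0 'k::field"
  assumes "v \<in> rep_space S x G"
    and "\<And>f. f \<in> rep_variety S x G \<Longrightarrow>
      tens_op p k F (bas (handle_word f)) = (bas (handle_word (rep_twist \<Psi> f)) :: ('g, 'k) tensors)"
  shows "tens_op p k F (Theta g S \<alpha> \<beta> G v) = Theta g S \<alpha> \<beta> G (rep_act S \<nu> x \<Psi> v)"
proof -
  have "tens_op p k F (Theta g S \<alpha> \<beta> G v) = lin_ext (\<lambda>f. tens_op p k F (bas (handle_word f))) v"
    by (subst (1 2) tens_op_def) (simp add: Theta_eq_lin_ext lin_ext_lin_ext)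
  also have "\<dots> = lin_ext (\<lambda>f. bas (handle_word (rep_twist \<Psi> f))) v"
    by (rule lin_ext_cong[of _ "rep_variety S x G"]) (use assms in \<open>auto simp: rep_space_def\<close>)
  also have "\<dots> = Theta g S \<alpha> \<beta> G (rep_act S \<nu> x \<Psi> v)"
    by (simp add: Theta_eq_lin_ext rep_act_eq_lin_ext lin_ext_lin_ext)
  finally show ?thesis .
qed

end

lemma tens_op_one_factor:
  assumes i: "i \<in> {1..g}" and F: "F (bas [\<phi> i]) = bas [\<psi> i]"
    and eq: "\<And>j. j \<in> {1..g} \<Longrightarrow> j \<noteq> i \<Longrightarrow> \<phi> j = \<psi> j"
  shows "tens_op (i - 1) 1 F (bas (map \<phi> [1..<Suc g])) = bas (map \<psi> [1..<Suc g])"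
proof -
  have "[1..<Suc g] = [1..<i] @ [i..<Suc g]"
    using upt_add_eq_append[of 1 i "Suc g - i"] i by simp
  also have "[i..<Suc g] = [i] @ [Suc i..<Suc g]"
    using i by (simp add: upt_conv_Cons del: upt_Suc)
  finally have split: "[1..<Suc g] = [1..<i] @ [i] @ [Suc i..<Suc g]" .
  have rest: "map \<phi> [1..<i] = map \<psi> [1..<i]" "map \<phi> [Suc i..<Suc g] = map \<psi> [Suc i..<Suc g]"
    using i by (auto intro!: eq simp del: upt_Suc)
  show ?thesis
    unfolding split map_append rest by (rule tens_op_bas) (use i F in simp_all)
qed

lemma tens_op_two_factors:
  assumes l: "l \<in> {1..<g}" and F: "F (bas [\<phi> l, \<phi> (l + 1)]) = bas [\<psi> l, \<psi> (l + 1)]"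
    and eq: "\<And>j. j \<in> {1..g} \<Longrightarrow> j \<noteq> l \<Longrightarrow> j \<noteq> l + 1 \<Longrightarrow> \<phi> j = \<psi> j"
  shows "tens_op (l - 1) 2 F (bas (map \<phi> [1..<Suc g])) = bas (map \<psi> [1..<Suc g])"
proof -
  have "[1..<Suc g] = [1..<l] @ [l..<Suc g]"
    using upt_add_eq_append[of 1 l "Suc g - l"] l by simp
  also have "[l..<Suc g] = [l, l + 1] @ [Suc (Suc l)..<Suc g]"
    using l by (simp add: upt_conv_Cons del: upt_Suc)
  finally have split: "[1..<Suc g] = [1..<l] @ [l, l + 1] @ [Suc (Suc l)..<Suc g]" .
  have rest: "map \<phi> [1..<l] = map \<psi> [1..<l]"
    "map \<phi> [Suc (Suc l)..<Suc g] = map \<psi> [Suc (Suc l)..<Suc g]"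
    using l by (auto intro!: eq simp del: upt_Suc)
  show ?thesis
    unfolding split map_append rest by (rule tens_op_bas) (use l F in simp_all)
qed

lemma (in group) inv_mult_cancel:
  assumes "y \<in> carrier G" "z \<in> carrier G"
  shows "inv y \<otimes> (y \<otimes> z) = z" "y \<otimes> (inv y \<otimes> z) = z"
  using assms by (simp_all flip: m_assoc)

context surface_reps
begin

text \<open>
  In the next three lemmas \<open>f'\<close>, the twisted representation, takes the values \<open>a', b'\<close>, and those
  of \<open>f\<close> follow from \<open>f = f' \<circ> \<psi>\<^sub>*\<close>. For \<open>T\<close> they are \<open>a = a'\<close> and \<open>b = b' a'\<close>, so the second entry
  \<open>a b\<^sup>-\<^sup>1\<close> of the image is \<open>b'\<^sup>-\<^sup>1\<close>.
\<close>

lemma T_op_handle_word: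
  assumes i: "i \<in> {1..g}" and \<Psi>: "\<Psi> \<in> carrier \<Gamma>" and f: "f \<in> rep_variety S x G"
    and act: "\<And>j. j \<in> {1..g} \<Longrightarrow> mcg_act S \<Psi> (a j) = a j"
      "\<And>j. j \<in> {1..g} \<Longrightarrow> mcg_act S \<Psi> (b j) = (if j = i then b i \<otimes>\<^bsub>P\<^esub> a i else b j)"
  shows "tens_op (i - 1) 1 (T_op G) (bas (handle_word f))
    = (bas (handle_word (rep_twist \<Psi> f)) :: ('g, 'k::field) tensors)"
proof -
  let ?f = "rep_twist \<Psi> f"
  interpret f': group_hom P G ?f
    by (rule rep_variety_group_hom[OF rep_twist_in_rep_variety[OF \<Psi> f]])
  note c = handle_loops_closed
  have fa: "f (a j) = ?f (a j)" and fb: "f (b j) = (if j = i then ?f (b i) \<otimes>\<^bsub>G\<^esub> ?f (a i) else ?f (b j))"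
    if "j \<in> {1..g}" for j
    using rep_twist_mcg_act[OF \<Psi> c(1)[OF that], of f] rep_twist_mcg_act[OF \<Psi> c(2)[OF that], of f]
      act[OF that] c that i by auto
  have i': "?f (a i) \<in> carrier G" "?f (b i) \<in> carrier G" using c i by auto
  show ?thesis
    unfolding handle_word_def
  proof (rule tens_op_one_factor[OF i])
    show "T_op G (bas [(f (a i), inv\<^bsub>G\<^esub> (f (b i)))]) = bas [(?f (a i), inv\<^bsub>G\<^esub> (?f (b i)))]"
      using i' by (simp add: fa[OF i] fb[OF i] T_op_def u_def G.inv_mult_group flip: G.m_assoc)
  qed (simp add: fa fb)
qed

text \<open>
  Here \<open>a = a' b' a'\<^sup>-\<^sup>1\<close> and \<open>b = a'\<^sup>-\<^sup>1\<close>, so the entries \<open>b\<^sup>-\<^sup>1\<close> and \<open>b a\<^sup>-\<^sup>1 b\<^sup>-\<^sup>1\<close> of the image are \<open>a'\<close>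
  and \<open>b'\<^sup>-\<^sup>1\<close>.
\<close>

lemma S_op_handle_word:
  assumes i: "i \<in> {1..g}" and \<Psi>: "\<Psi> \<in> carrier \<Gamma>" and f: "f \<in> rep_variety S x G"
    and act: "\<And>j. j \<in> {1..g} \<Longrightarrow>
        mcg_act S \<Psi> (a j) = (if j = i then a i \<otimes>\<^bsub>P\<^esub> b i \<otimes>\<^bsub>P\<^esub> inv\<^bsub>P\<^esub> (a i) else a j)"
      "\<And>j. j \<in> {1..g} \<Longrightarrow> mcg_act S \<Psi> (b j) = (if j = i then inv\<^bsub>P\<^esub> (a i) else b j)"
  shows "tens_op (i - 1) 1 (S_op G) (bas (handle_word f))
    = (bas (handle_word (rep_twist \<Psi> f)) :: ('g, 'k::field) tensors)"
proof -
  let ?f = "rep_twist \<Psi> f"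
  interpret f': group_hom P G ?f
    by (rule rep_variety_group_hom[OF rep_twist_in_rep_variety[OF \<Psi> f]])
  note c = handle_loops_closed
  have fa: "f (a j) = (if j = i then ?f (a i) \<otimes>\<^bsub>G\<^esub> ?f (b i) \<otimes>\<^bsub>G\<^esub> inv\<^bsub>G\<^esub> (?f (a i)) else ?f (a j))"
    and fb: "f (b j) = (if j = i then inv\<^bsub>G\<^esub> (?f (a i)) else ?f (b j))"
    if "j \<in> {1..g}" for j
    using rep_twist_mcg_act[OF \<Psi> c(1)[OF that], of f] rep_twist_mcg_act[OF \<Psi> c(2)[OF that], of f]
      act[OF that] c that i by auto
  have i': "?f (a i) \<in> carrier G" "?f (b i) \<in> carrier G" using c i by auto
  show ?thesis
    unfolding handle_word_def
  proof (rule tens_op_one_factor[OF i])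
    show "S_op G (bas [(f (a i), inv\<^bsub>G\<^esub> (f (b i)))]) = bas [(?f (a i), inv\<^bsub>G\<^esub> (?f (b i)))]"
      using i' by (simp add: fa[OF i] fb[OF i] S_op_def u_def G.inv_mult_group G.m_assoc G.inv_mult_cancel)
  qed (simp add: fa fb)
qed

text \<open>
  Everything hinges on the element \<open>n\<close> in the formula for \<open>N\<close> being the value of \<open>f'\<close> at the
  loop \<open>m\<close> by which the mapping class multiplies and conjugates; then the factors \<open>n\<close> in the
  operator undo precisely those multiplications and conjugations.
\<close>

lemma N_op_handle_word:
  assumes l: "l \<in> {1..<g}" and \<Psi>: "\<Psi> \<in> carrier \<Gamma>" and f: "f \<in> rep_variety S x G"
    and m: "m = inv\<^bsub>P\<^esub> (a (l + 1)) \<otimes>\<^bsub>P\<^esub> b l \<otimes>\<^bsub>P\<^esub> a l \<otimes>\<^bsub>P\<^esub> inv\<^bsub>P\<^esub> (b l)"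
    and act: "\<And>j. j \<in> {1..g} \<Longrightarrow>
        mcg_act S \<Psi> (a j) = (if j = l + 1 then m \<otimes>\<^bsub>P\<^esub> a (l + 1) \<otimes>\<^bsub>P\<^esub> inv\<^bsub>P\<^esub> m else a j)"
      "\<And>j. j \<in> {1..g} \<Longrightarrow> mcg_act S \<Psi> (b j) =
        (if j = l then m \<otimes>\<^bsub>P\<^esub> b l else if j = l + 1 then b (l + 1) \<otimes>\<^bsub>P\<^esub> inv\<^bsub>P\<^esub> m else b j)"
  shows "tens_op (l - 1) 2 (N_op G) (bas (handle_word f))
    = (bas (handle_word (rep_twist \<Psi> f)) :: ('g, 'k::field) tensors)"
proof -
  let ?f = "rep_twist \<Psi> f"
  interpret f': group_hom P G ?f
    by (rule rep_variety_group_hom[OF rep_twist_in_rep_variety[OF \<Psi> f]])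
  note c = handle_loops_closed
  have l': "l \<in> {1..g}" "l + 1 \<in> {1..g}" using l by auto
  have mP: "m \<in> carrier P" using c l' by (simp add: m)
  have fa: "f (a j) = (if j = l + 1 then ?f m \<otimes>\<^bsub>G\<^esub> ?f (a (l + 1)) \<otimes>\<^bsub>G\<^esub> inv\<^bsub>G\<^esub> (?f m) else ?f (a j))"
    and fb: "f (b j) = (if j = l then ?f m \<otimes>\<^bsub>G\<^esub> ?f (b l)
       else if j = l + 1 then ?f (b (l + 1)) \<otimes>\<^bsub>G\<^esub> inv\<^bsub>G\<^esub> (?f m) else ?f (b j))"
    if "j \<in> {1..g}" for j
    using rep_twist_mcg_act[OF \<Psi> c(1)[OF that], of f] rep_twist_mcg_act[OF \<Psi> c(2)[OF that], of f]
      act[OF that] c l' mP that by auto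
  define A B A' B' M where defs: "A = ?f (a l)" "B = ?f (b l)" "A' = ?f (a (l + 1))" "B' = ?f (b (l + 1))"
    "M = ?f m"
  have car: "A \<in> carrier G" "B \<in> carrier G" "A' \<in> carrier G" "B' \<in> carrier G" "M \<in> carrier G"
    using c l' mP by (auto simp: defs)
  have M: "M = inv\<^bsub>G\<^esub> A' \<otimes>\<^bsub>G\<^esub> B \<otimes>\<^bsub>G\<^esub> A \<otimes>\<^bsub>G\<^esub> inv\<^bsub>G\<^esub> B" using c l' by (simp add: defs m)
  have vals: "f (a l) = A" "f (b l) = M \<otimes>\<^bsub>G\<^esub> B" "f (a (l + 1)) = M \<otimes>\<^bsub>G\<^esub> A' \<otimes>\<^bsub>G\<^esub> inv\<^bsub>G\<^esub> M"
    "f (b (l + 1)) = B' \<otimes>\<^bsub>G\<^esub> inv\<^bsub>G\<^esub> M"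
    using fa[OF l'(1)] fa[OF l'(2)] fb[OF l'(1)] fb[OF l'(2)] by (simp_all add: defs)
  \<comment> \<open>Computed from the values of \<open>f\<close>, the element \<open>n\<close> is the conjugate of \<open>M\<close> by itself.\<close>
  have n: "inv\<^bsub>G\<^esub> (M \<otimes>\<^bsub>G\<^esub> A' \<otimes>\<^bsub>G\<^esub> inv\<^bsub>G\<^esub> M) \<otimes>\<^bsub>G\<^esub> (M \<otimes>\<^bsub>G\<^esub> B) \<otimes>\<^bsub>G\<^esub> A \<otimes>\<^bsub>G\<^esub> inv\<^bsub>G\<^esub> (M \<otimes>\<^bsub>G\<^esub> B) = M"
  proof -
    have "inv\<^bsub>G\<^esub> (M \<otimes>\<^bsub>G\<^esub> A' \<otimes>\<^bsub>G\<^esub> inv\<^bsub>G\<^esub> M) \<otimes>\<^bsub>G\<^esub> (M \<otimes>\<^bsub>G\<^esub> B) \<otimes>\<^bsub>G\<^esub> A \<otimes>\<^bsub>G\<^esub> inv\<^bsub>G\<^esub> (M \<otimes>\<^bsub>G\<^esub> B)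
        = M \<otimes>\<^bsub>G\<^esub> (inv\<^bsub>G\<^esub> A' \<otimes>\<^bsub>G\<^esub> B \<otimes>\<^bsub>G\<^esub> A \<otimes>\<^bsub>G\<^esub> inv\<^bsub>G\<^esub> B) \<otimes>\<^bsub>G\<^esub> inv\<^bsub>G\<^esub> M"
      using car by (simp add: G.inv_mult_group G.m_assoc G.inv_mult_cancel)
    also have "\<dots> = M \<otimes>\<^bsub>G\<^esub> M \<otimes>\<^bsub>G\<^esub> inv\<^bsub>G\<^esub> M" by (simp only: M[symmetric])
    also have "\<dots> = M" using car by (simp add: G.m_assoc)
    finally show ?thesis .
  qed
  show ?thesis
    unfolding handle_word_def
  proof (rule tens_op_two_factors[OF l])
    show "N_op G (bas [(f (a l), inv\<^bsub>G\<^esub> (f (b l))), (f (a (l + 1)), inv\<^bsub>G\<^esub> (f (b (l + 1))))])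
      = bas [(?f (a l), inv\<^bsub>G\<^esub> (?f (b l))), (?f (a (l + 1)), inv\<^bsub>G\<^esub> (?f (b (l + 1))))]"
      using car unfolding vals defs[symmetric]
      by (simp add: N_op_def Let_def n u_def tens_bas)
         (simp add: G.inv_mult_group G.m_assoc G.inv_mult_cancel)
  qed (simp add: fa fb)
qed

end

section \<open>The isomorphism\<close>

text \<open>The group elements at which \<open>f\<close> intertwines the two actions form a subgroup.\<close>

lemma equivariant_if_on_generators:
  assumes V: "group_module H V \<rho>" and W: "group_module H W \<sigma>" and f: "f ` V \<subseteq> W"
    and X: "X \<subseteq> carrier H" "generate H X = carrier H"
    and eq: "\<And>h v. h \<in> X \<Longrightarrow> v \<in> V \<Longrightarrow> f (\<rho> h v) = \<sigma> h (f v)"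
    and h: "h \<in> carrier H" and v: "v \<in> V"
  shows "f (\<rho> h v) = \<sigma> h (f v)"
proof -
  interpret H: group H using V by (simp add: group_module_def)
  have \<rho>V: "\<rho> h v \<in> V" if "h \<in> carrier H" "v \<in> V" for h v
    using V that by (force simp: group_module_def linear_betw_def)
  have fW: "f v \<in> W" if "v \<in> V" for v using f that by blast
  have unit: "\<rho> \<one>\<^bsub>H\<^esub> v = v" "\<sigma> \<one>\<^bsub>H\<^esub> (f v) = f v" if "v \<in> V" for v
    using V W fW[OF that] that by (auto simp: group_module_def)
  have mult: "\<rho> (h \<otimes>\<^bsub>H\<^esub> k) v = \<rho> h (\<rho> k v)" "\<sigma> (h \<otimes>\<^bsub>H\<^esub> k) (f v) = \<sigma> h (\<sigma> k (f v))"
    if "h \<in> carrier H" "k \<in> carrier H" "v \<in> V" for h k v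
    using V W fW[OF that(3)] that by (auto simp: group_module_def)
  from h have "h \<in> generate H X" by (simp add: X)
  then show ?thesis
    using v
  proof (induction arbitrary: v)
    case one
    then show ?case using unit by simp
  next
    case (incl h)
    then show ?case by (rule eq)
  next
    case (inv h)
    then have h: "h \<in> carrier H" using X by blast
    let ?v = "\<rho> (inv\<^bsub>H\<^esub> h) v"
    have v': "?v \<in> V" using \<rho>V h inv by simp
    have "\<rho> h ?v = v" using mult(1)[of h "inv\<^bsub>H\<^esub> h" v] unit h inv by simp
    then have "f v = \<sigma> h (f ?v)" using eq[OF inv(1) v'] by simp
    then have "\<sigma> (inv\<^bsub>H\<^esub> h) (f v) = \<sigma> (inv\<^bsub>H\<^esub> h \<otimes>\<^bsub>H\<^esub> h) (f ?v)"
      using mult(2)[of "inv\<^bsub>H\<^esub> h" h ?v] h v' by simp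
    then show ?case using unit(2)[OF v'] h by simp
  next
    case (eng h k)
    then have hk: "h \<in> carrier H" "k \<in> carrier H" using X by auto
    then show ?case using eng mult \<rho>V by simp
  qed
qed

theorem theorem4p28:
  fixes G :: "('g, 'm) monoid_scheme"
    and g :: nat
    and S :: "(real ^ 3) set" and \<nu> :: "real ^ 3 \<Rightarrow> real ^ 3" and x :: "real ^ 3"
    and \<alpha> \<beta> :: "nat \<Rightarrow> real \<Rightarrow> real ^ 3"
    and t s n :: "nat \<Rightarrow> (real ^ 3 \<Rightarrow> real ^ 3) set"
  assumes "group G" and "finite (carrier G)"
    and "marked_surface g S \<nu> x \<alpha> \<beta>"
    and "mcg_generators g S \<nu> x \<alpha> \<beta> t s n"
  shows "(\<exists>\<rho> :: _ \<Rightarrow> ('g, 'k::alg_closed_field) tensors \<Rightarrow> _.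
            lyubashenko_action g S \<nu> x t s n G \<rho>) \<and>
         (\<forall>\<rho> :: _ \<Rightarrow> ('g, 'k) tensors \<Rightarrow> _.
            lyubashenko_action g S \<nu> x t s n G \<rho> \<longrightarrow>
            group_module_iso (mapping_class_group S \<nu> x)
              (rep_space S x G) (rep_act S \<nu> x)
              (Ltens_e G g) \<rho>
              (Theta g S \<alpha> \<beta> G))"
proof -
  interpret surface_reps G g S \<nu> x \<alpha> \<beta> by (rule surface_reps.intro) fact+
  let ?V = "rep_space S x G :: (((real \<Rightarrow> pt) set \<Rightarrow> 'g) \<Rightarrow>\<^sub>0 'k) set"
  let ?W = "Ltens_e G g :: ('g, 'k) tensors set"
  let ?\<Theta> = "Theta g S \<alpha> \<beta> G :: (((real \<Rightarrow> pt) set \<Rightarrow> 'g) \<Rightarrow>\<^sub>0 'k) \<Rightarrow> _"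
  let ?\<Theta>' = "lin_ext (\<lambda>w. bas (inv_into (rep_variety S x G) handle_word w))
    :: ('g, 'k) tensors \<Rightarrow> ((real \<Rightarrow> pt) set \<Rightarrow> 'g) \<Rightarrow>\<^sub>0 'k"
  note W = Ltens_e_eq_free_space[OF assms(1,2)]
  note bij = bij_betw_handle_word
  note maps = bij_betwE[OF bij] bij_betwE[OF bij_betw_inv_into[OF bij]]
  have lin: "linear_betw ?V ?W ?\<Theta>" and lin': "linear_betw ?W ?V ?\<Theta>'"
    unfolding W rep_space_def Theta_eq_lin_ext
    by (rule linear_betw_lin_ext; use maps in \<open>simp add: free_space_bas\<close>)+
  have bij_\<Theta>: "bij_betw ?\<Theta> ?V ?W"
    unfolding W rep_space_def Theta_eq_lin_ext by (rule bij_betw_lin_ext_bas) (rule bij)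
  have \<Theta>\<Theta>': "?\<Theta> (?\<Theta>' w) = w" if "w \<in> ?W" for w
    unfolding Theta_eq_lin_ext
    by (rule lin_ext_bas_left_inverse[of _ "neutral_words G g"])
       (use that bij in \<open>auto simp: W bij_betw_inv_into_right\<close>)
  have \<Theta>'\<Theta>: "?\<Theta>' (?\<Theta> v) = v" if "v \<in> ?V" for v
    unfolding Theta_eq_lin_ext
    by (rule lin_ext_bas_left_inverse[of _ "rep_variety S x G"])
       (use that bij in \<open>auto simp: rep_space_def bij_betw_inv_into_left\<close>)

  note gens = assms(4)[unfolded mcg_generators_def Let_def]
  have t: "tens_op (i - 1) 1 (T_op G) (?\<Theta> v) = ?\<Theta> (rep_act S \<nu> x (t i) v)"
    and s: "tens_op (i - 1) 1 (S_op G) (?\<Theta> v) = ?\<Theta> (rep_act S \<nu> x (s i) v)"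
    if "i \<in> {1..g}" "v \<in> ?V" for i v
    by (rule tens_op_Theta[OF that(2)], (rule T_op_handle_word[OF that(1)] S_op_handle_word[OF that(1)]);
        use gens that(1) in simp)+
  have n: "tens_op (l - 1) 2 (N_op G) (?\<Theta> v) = ?\<Theta> (rep_act S \<nu> x (n l) v)"
    if "l \<in> {1..<g}" "v \<in> ?V" for l v
    by (rule tens_op_Theta[OF that(2)], rule N_op_handle_word[OF that(1) _ _ refl])
       (use gens that(1) in simp_all)

  have "lyubashenko_action g S \<nu> x t s n G (\<lambda>\<Psi> w. ?\<Theta> (rep_act S \<nu> x \<Psi> (?\<Theta>' w)))"
    unfolding lyubashenko_action_def
  proof (intro conjI ballI)
    show "group_module \<Gamma> ?W (\<lambda>\<Psi> w. ?\<Theta> (rep_act S \<nu> x \<Psi> (?\<Theta>' w)))"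
      by (rule group_module_transfer[OF group_module_rep_space lin lin'])
         (simp_all add: \<Theta>\<Theta>' \<Theta>'\<Theta>, simp add: W subspace_free_space)
    fix w assume w: "w \<in> ?W"
    then have v: "?\<Theta>' w \<in> ?V" using lin' by (auto simp: linear_betw_def)
    show "?\<Theta> (rep_act S \<nu> x (t i) (?\<Theta>' w)) = tens_op (i - 1) 1 (T_op G) w"
      "?\<Theta> (rep_act S \<nu> x (s i) (?\<Theta>' w)) = tens_op (i - 1) 1 (S_op G) w" if "i \<in> {1..g}" for i
      using t[OF that v] s[OF that v] \<Theta>\<Theta>'[OF w] by simp_all
    show "?\<Theta> (rep_act S \<nu> x (n l) (?\<Theta>' w)) = tens_op (l - 1) 2 (N_op G) w" if "l \<in> {1..<g}" for l
      using n[OF that v] \<Theta>\<Theta>'[OF w] by simp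
  qed
  moreover have "group_module_iso \<Gamma> ?V (rep_act S \<nu> x) ?W \<rho> ?\<Theta>"
    if \<rho>: "lyubashenko_action g S \<nu> x t s n G \<rho>" for \<rho>
  proof -
    note \<rho> = \<rho>[unfolded lyubashenko_action_def]
    let ?X = "t ` {1..g} \<union> s ` {1..g} \<union> n ` {1..<g}"
    have \<Theta>W: "?\<Theta> ` ?V \<subseteq> ?W" using bij_\<Theta> by (simp add: bij_betw_def)
    have "?\<Theta> (rep_act S \<nu> x \<Psi> v) = \<rho> \<Psi> (?\<Theta> v)" if "\<Psi> \<in> carrier \<Gamma>" "v \<in> ?V" for \<Psi> v
    proof (rule equivariant_if_on_generators[OF group_module_rep_space _ \<Theta>W _ _ _ that, where X = ?X])
      show "group_module \<Gamma> ?W \<rho>" using \<rho> by blast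
      show "?X \<subseteq> carrier \<Gamma>" "generate \<Gamma> ?X = carrier \<Gamma>" using gens by auto
      fix h v assume h: "h \<in> ?X" and v: "v \<in> ?V"
      then have "?\<Theta> v \<in> ?W" using \<Theta>W by blast
      then show "?\<Theta> (rep_act S \<nu> x h v) = \<rho> h (?\<Theta> v)"
        using h \<rho> t[OF _ v] s[OF _ v] n[OF _ v] by auto
    qed
    then show ?thesis
      using group_module_rep_space lin bij_\<Theta> \<rho> by (simp add: group_module_iso_def)
  qed
  ultimately show ?thesis by blast
qed

end
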